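(* Consider a spherically symmetric solution of the Einstein-Maxwell-charged scalar field system with coupling constant $\mathfrak{e}$ in double null coordinates, in the setting described in the context, defined on $\mathcal{D}(0,v_1)\cup([u_0,u_*]\times[v_1,v_2])$ (with data on $C\cup\underline{C}$). Let $$\epsilon:=\sup_{C\cup\underline{C}}\frac{Q^2}{r^2}<1,\qquad L:=\sup_{\underline{C}} r|\phi|^2 .$$ Let $\omega$ be any constant in $(0,\frac23)$ and suppose that $v_2-v_1$ is so small that $$\frac{9\mathfrak{e}^2}{4(1-\epsilon)^2}(v_2-v_1)^2+\frac{12\pi L\mathfrak{e}^2}{1-\epsilon}(v_2-v_1)\le\frac{\omega}{4}$$ and, for all $u\in[u_0,0]$, $$\frac{45\pi\mathfrak{e}^2(v_2-v_1)^2}{\pi(1-\epsilon)^2}+160\pi\mathfrak{e}^2\, r(u_0,v_2)\frac{v_2-v_1}{1-\epsilon}|\phi(u,v_1)|^2\le 4\omega .$$ Suppose further that the initial data along $\underline{C}$ are not supercharged, i.e. $m(u,v_1)\ge|Q|(u,v_1)$ for all $u\in[u_0,0]$. Put $$g_\omega(x):=\frac{1+\frac{\omega}{2}}{1-\frac{\omega}{2}}\,\frac{1}{(1+x)^2}\left(\left(\frac{2^{1-\frac{\omega}{2}}}{\omega}+\frac{1}{2^{1+\frac{\omega}{2}}(1+\frac{\omega}{2})}\right)x^{1-\frac{\omega}{2}}-\frac{2}{\omega}x-\frac{1}{1+\frac{\omega}{2}}x^2\right).$$ If $$\eta_0>\max\left\{\frac{13\epsilon}{\omega}+g_\omega(\delta_0),\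 \frac{9}{2^{1+\frac{\omega}{2}}(1+\delta_0)^2}\,\delta_0^{1-\frac{\omega}{2}}+g_\omega(\delta_0)\right\},$$ then a trapped surface forms in $[u_0,u_*]\times[v_1,v_2]$.
   Context: Metric: $g=-\Omega^2(u,v)\,du\,dv+r^2(u,v)(d\theta^2+\sin^2\theta\,d\varphi^2)$, $\Omega>0$; each $(u,v)$ represents a 2-sphere. Unknowns: real $r,\Omega,A_u$ and complex $\phi$, functions of $(u,v)$; gauge $A_v\equiv 0$; $\mathfrak{e}$ is a real constant, $D_u=\partial_u+i\mathfrak{e}A_u$, $\dagger$ is complex conjugation. The charge is $Q=2r^2\Omega^{-2}F_{uv}=-2r^2\Omega^{-2}\partial_vA_u$. The Einstein-Maxwell-charged scalar field system in spherical symmetry is $$r\partial_v\partial_u r+\partial_v r\,\partial_u r=-\tfrac{\Omega^2}{4}\big(1-\tfrac{Q^2}{r^2}\big),$$ $$r^2\partial_u\partial_v\log\Omega=-2\pi r^2\big(D_u\phi(\partial_v\phi)^\dagger+\partial_v\phi(D_u\phi)^\dagger\big)-\tfrac12\Omega^2\tfrac{Q^2}{r^2}+\tfrac14\Omega^2+\partial_u r\,\partial_v r,$$ $$\partial_u(\Omega^{-2}\partial_u r)=-4\pi r\Omega^{-2}|D_u\phi|^2,\qquad \partial_v(\Omega^{-2}\partial_v r)=-4\pi r\Omega^{-2}|\partial_v\phi|^2,$$ $$r\partial_u\partial_v\phi+\partial_u r\,\partial_v\phi+\partial_v r\,\partial_u\phi+\mathfrak{e}i\big(A_u\partial_v(r\phi)-\tfrac{\Omega^2}{4}\tfrac{Q}{r}\phi\big)=0,$$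 $$\partial_uQ=4\pi\mathfrak{e}r^2\,\mathrm{Im}(\phi^\dagger D_u\phi),\qquad \partial_vQ=-4\pi\mathfrak{e}r^2\,\mathrm{Im}(\phi^\dagger\partial_v\phi).$$ Coordinates: $u_0<0<v_1<v_2$. $\Gamma$ is the center of symmetry, where $r=0$; $r>0$ away from $\Gamma$, and the solution is smooth with $m=Q=0$ on $\Gamma$ (suprema of $Q^2/r^2$ are over points with $r>0$). $C=\{u=u_0,\ v\ge 0\}$ is the outgoing initial cone, meeting $\Gamma$ at $(u_0,0)$; $\underline{C}=\{v=v_1,\ u_0\le u\le 0\}$ is the incoming initial cone, meeting $\Gamma$ at $(0,v_1)$. $\mathcal{D}(0,v_1)$ is the region bounded by $C$, $\underline{C}$, $\Gamma$. Normalization: $\Omega^2=1$ on $C\cup\underline{C}$ and $\partial_v r(u_0,0)=-\partial_u r(u_0,0)$. Initially there is no trapped surface or MOTS along $v=v_1$ or in $\mathcal{D}(0,v_1)$. Hawking mass: $m=\frac r2(1+4\Omega^{-2}\partial_u r\,\partial_v r)$. Notation: $r_i(u)=r(u,v_i)$, $m_i(u)=m(u,v_i)$, $i=1,2$; $\delta_0=\frac{r_2(u_0)}{r_1(u_0)}-1$; $\eta_0=\frac{2(m_2(u_0)-m_1(u_0))}{r_2(u_0)}$. $u_*\in[u_0,0]$ is the value of $u$ (assumed to exist) with $r_2(u_* )=\frac{3\delta_0}{1+\delta_0}r_2(u_0)$. A point $(u,v)$ is a trapped surface if $\partial_u r(u,v)<0$ and $\partial_v r(u,v)<0$; it is a MOTS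 if $\partial_v r(u,v)=0$. *)

theory Defs
  imports "HOL-Analysis.Analysis"
begin

text \<open>
  All unknowns are functions of the double null coordinates \<open>(u, v)\<close>, curried; vector
  derivatives serve the real-valued and the complex-valued unknowns alike.
\<close>

definition du :: "(real \<Rightarrow> real \<Rightarrow> 'a::real_normed_vector) \<Rightarrow> real \<Rightarrow> real \<Rightarrow> 'a" where
  "du f u v = vector_derivative (\<lambda>s. f s v) (at u)"

definition dv :: "(real \<Rightarrow> real \<Rightarrow> 'a::real_normed_vector) \<Rightarrow> real \<Rightarrow> real \<Rightarrow> 'a" where
  "dv f u v = vector_derivative (\<lambda>s. f u s) (at v)"

text \<open>On an open set \<open>U\<close>, \<open>Ck_on k U\<close> is the class of \<open>k\<close> times continuously differentiable functions.\<close>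

primrec Ck_on :: "nat \<Rightarrow> (real \<times> real) set \<Rightarrow> (real \<Rightarrow> real \<Rightarrow> 'a::real_normed_vector) \<Rightarrow> bool" where
  "Ck_on 0 U f \<longleftrightarrow> continuous_on U (\<lambda>(u, v). f u v)"
| "Ck_on (Suc k) U f \<longleftrightarrow>
     continuous_on U (\<lambda>(u, v). f u v) \<and>
     (\<forall>(u, v) \<in> U. (\<lambda>s. f s v) differentiable (at u) \<and> (\<lambda>s. f u s) differentiable (at v)) \<and>
     Ck_on k U (du f) \<and> Ck_on k U (dv f)"

text \<open>
  Smoothness up to the boundary of a region \<open>S\<close> that need not be open: the functions are smooth on
  some open neighbourhood of \<open>S\<close>, so that derivatives at boundary points are two-sided ones of the
  extension. No field equation is imposed outside \<open>S\<close>.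
\<close>

definition smooth_near :: "(real \<times> real) set \<Rightarrow> (real \<Rightarrow> real \<Rightarrow> 'a::real_normed_vector) \<Rightarrow> bool" where
  "smooth_near S f \<longleftrightarrow> (\<exists>U. open U \<and> S \<subseteq> U \<and> (\<forall>k. Ck_on k U f))"

text \<open>
  Gauge \<open>A\<^sub>v = 0\<close>: the potential \<open>A\<close> is \<open>A\<^sub>u\<close>, so \<open>F\<^sub>u\<^sub>v = - \<partial>\<^sub>v A\<^sub>u\<close>.
\<close>

definition charge ::
  "(real \<Rightarrow> real \<Rightarrow> real) \<Rightarrow> (real \<Rightarrow> real \<Rightarrow> real) \<Rightarrow> (real \<Rightarrow> real \<Rightarrow> real) \<Rightarrow> real \<Rightarrow> real \<Rightarrow> real" where
  "charge r \<Omega> A u v = - (2 * (r u v)\<^sup>2 / (\<Omega> u v)\<^sup>2 * dv A u v)"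

definition gauge_du ::
  "real \<Rightarrow> (real \<Rightarrow> real \<Rightarrow> real) \<Rightarrow> (real \<Rightarrow> real \<Rightarrow> complex) \<Rightarrow> real \<Rightarrow> real \<Rightarrow> complex" where
  "gauge_du e A \<phi> u v = du \<phi> u v + \<i> * of_real (e * A u v) * \<phi> u v"

definition hawking_mass ::
  "(real \<Rightarrow> real \<Rightarrow> real) \<Rightarrow> (real \<Rightarrow> real \<Rightarrow> real) \<Rightarrow> real \<Rightarrow> real \<Rightarrow> real" where
  "hawking_mass r \<Omega> u v = r u v / 2 * (1 + 4 / (\<Omega> u v)\<^sup>2 * du r u v * dv r u v)"

definition trapped_surface :: "(real \<Rightarrow> real \<Rightarrow> real) \<Rightarrow> real \<Rightarrow> real \<Rightarrow> bool" where
  "trapped_surface r u v \<longleftrightarrow> du r u v < 0 \<and> dv r u v < 0"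

definition MOTS :: "(real \<Rightarrow> real \<Rightarrow> real) \<Rightarrow> real \<Rightarrow> real \<Rightarrow> bool" where
  "MOTS r u v \<longleftrightarrow> dv r u v = 0"

text \<open>
  The two equations of the system that only involve derivatives along the outgoing direction.
\<close>

definition outgoing_constraints ::
  "real \<Rightarrow> (real \<Rightarrow> real \<Rightarrow> real) \<Rightarrow> (real \<Rightarrow> real \<Rightarrow> real) \<Rightarrow> (real \<Rightarrow> real \<Rightarrow> real)
     \<Rightarrow> (real \<Rightarrow> real \<Rightarrow> complex) \<Rightarrow> real \<Rightarrow> real \<Rightarrow> bool" where
  "outgoing_constraints e r \<Omega> A \<phi> u v \<longleftrightarrow>
     dv (\<lambda>u v. dv r u v / (\<Omega> u v)\<^sup>2) u v
       = - 4 * pi * r u v / (\<Omega> u v)\<^sup>2 * (cmod (dv \<phi> u v))\<^sup>2 \<and>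
     dv (charge r \<Omega> A) u v = - 4 * pi * e * (r u v)\<^sup>2 * Im (cnj (\<phi> u v) * dv \<phi> u v)"

definition EMCSF_system ::
  "real \<Rightarrow> (real \<Rightarrow> real \<Rightarrow> real) \<Rightarrow> (real \<Rightarrow> real \<Rightarrow> real) \<Rightarrow> (real \<Rightarrow> real \<Rightarrow> real)
     \<Rightarrow> (real \<Rightarrow> real \<Rightarrow> complex) \<Rightarrow> real \<Rightarrow> real \<Rightarrow> bool" where
  "EMCSF_system e r \<Omega> A \<phi> u v \<longleftrightarrow>
     (let Q = charge r \<Omega> A; D = gauge_du e A \<phi> in
       r u v * dv (du r) u v + dv r u v * du r u v
         = - ((\<Omega> u v)\<^sup>2 / 4) * (1 - (Q u v)\<^sup>2 / (r u v)\<^sup>2) \<and>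
       of_real ((r u v)\<^sup>2 * du (dv (\<lambda>u v. ln (\<Omega> u v))) u v)
         = - of_real (2 * pi * (r u v)\<^sup>2) * (D u v * cnj (dv \<phi> u v) + dv \<phi> u v * cnj (D u v))
           + of_real (- (1/2) * (\<Omega> u v)\<^sup>2 * ((Q u v)\<^sup>2 / (r u v)\<^sup>2) + 1/4 * (\<Omega> u v)\<^sup>2
                      + du r u v * dv r u v) \<and>
       du (\<lambda>u v. du r u v / (\<Omega> u v)\<^sup>2) u v
         = - 4 * pi * r u v / (\<Omega> u v)\<^sup>2 * (cmod (D u v))\<^sup>2 \<and>
       of_real (r u v) * du (dv \<phi>) u v + of_real (du r u v) * dv \<phi> u v
         + of_real (dv r u v) * du \<phi> u v
         + of_real e * \<i> * (of_real (A u v) * dv (\<lambda>u v. of_real (r u v) * \<phi> u v) u v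
                           - of_real ((\<Omega> u v)\<^sup>2 / 4 * (Q u v / r u v)) * \<phi> u v) = 0 \<and>
       du Q u v = 4 * pi * e * (r u v)\<^sup>2 * Im (cnj (\<phi> u v) * D u v) \<and>
       outgoing_constraints e r \<Omega> A \<phi> u v)"

definition outgoing_cone :: "real \<Rightarrow> (real \<times> real) set" where
  "outgoing_cone u\<^sub>0 = {u\<^sub>0} \<times> {0..}"

definition incoming_cone :: "real \<Rightarrow> real \<Rightarrow> (real \<times> real) set" where
  "incoming_cone u\<^sub>0 v\<^sub>1 = {u\<^sub>0..0} \<times> {v\<^sub>1}"

text \<open>The center of symmetry is the curve \<open>v = \<gamma> u\<close>, \<open>u\<^sub>0 \<le> u \<le> 0\<close>.\<close>

definition center :: "real \<Rightarrow> (real \<Rightarrow> real) \<Rightarrow> (real \<times> real) set" where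
  "center u\<^sub>0 \<gamma> = (\<lambda>u. (u, \<gamma> u)) ` {u\<^sub>0..0}"

definition initial_region :: "real \<Rightarrow> real \<Rightarrow> (real \<Rightarrow> real) \<Rightarrow> (real \<times> real) set" where
  "initial_region u\<^sub>0 v\<^sub>1 \<gamma> = {(u, v). u\<^sub>0 \<le> u \<and> u \<le> 0 \<and> \<gamma> u \<le> v \<and> v \<le> v\<^sub>1}"

text \<open>
  The field equations are imposed where \<open>r > 0\<close>; since every term, \<open>Q / r\<close> included, is continuous
  up to the center, this determines them there as well. The cone \<open>C\<close> is unbounded, so its part with
  \<open>v > v\<^sub>2\<close> lies outside the region where the solution is given; there the data satisfy the
  constraint equations along \<open>C\<close>.
\<close>

locale EMCSF_solution =
  fixes e :: real
    and r \<Omega> A :: "real \<Rightarrow> real \<Rightarrow> real"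
    and \<phi> :: "real \<Rightarrow> real \<Rightarrow> complex"
    and \<gamma> :: "real \<Rightarrow> real"
    and u\<^sub>0 u\<^sub>s v\<^sub>1 v\<^sub>2 :: real
    and region :: "(real \<times> real) set"
  defines "region \<equiv> initial_region u\<^sub>0 v\<^sub>1 \<gamma> \<union> {u\<^sub>0..u\<^sub>s} \<times> {v\<^sub>1..v\<^sub>2}"
  assumes coordinates: "u\<^sub>0 < 0" "0 < v\<^sub>1" "v\<^sub>1 < v\<^sub>2" "u\<^sub>s \<in> {u\<^sub>0..0}"
    and center_curve: "continuous_on {u\<^sub>0..0} \<gamma>" "strict_mono_on {u\<^sub>0..0} \<gamma>"
      "\<gamma> u\<^sub>0 = 0" "\<gamma> 0 = v\<^sub>1"
    and smooth: "smooth_near (region \<union> outgoing_cone u\<^sub>0) r"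
      "smooth_near (region \<union> outgoing_cone u\<^sub>0) \<Omega>"
      "smooth_near (region \<union> outgoing_cone u\<^sub>0) A"
      "smooth_near (region \<union> outgoing_cone u\<^sub>0) \<phi>"
    and lapse_pos: "(u, v) \<in> region \<union> outgoing_cone u\<^sub>0 \<Longrightarrow> \<Omega> u v > 0"
    and radius_center: "(u, v) \<in> center u\<^sub>0 \<gamma> \<Longrightarrow> r u v = 0"
    and radius_pos: "(u, v) \<in> region \<union> outgoing_cone u\<^sub>0 - center u\<^sub>0 \<gamma> \<Longrightarrow> r u v > 0"
    and mass_center: "(u, v) \<in> center u\<^sub>0 \<gamma> \<Longrightarrow> hawking_mass r \<Omega> u v = 0"
    and charge_center: "(u, v) \<in> center u\<^sub>0 \<gamma> \<Longrightarrow> charge r \<Omega> A u v = 0"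
    and system: "(u, v) \<in> region \<Longrightarrow> r u v > 0 \<Longrightarrow> EMCSF_system e r \<Omega> A \<phi> u v"
    and constraints: "(u, v) \<in> outgoing_cone u\<^sub>0 \<Longrightarrow> r u v > 0 \<Longrightarrow>
      outgoing_constraints e r \<Omega> A \<phi> u v"
    and lapse_normalized: "(u, v) \<in> outgoing_cone u\<^sub>0 \<union> incoming_cone u\<^sub>0 v\<^sub>1 \<Longrightarrow> (\<Omega> u v)\<^sup>2 = 1"
    and vertex_normalized: "dv r u\<^sub>0 0 = - du r u\<^sub>0 0"
    and initially_untrapped: "(u, v) \<in> initial_region u\<^sub>0 v\<^sub>1 \<gamma> \<union> incoming_cone u\<^sub>0 v\<^sub>1 \<Longrightarrow>
      \<not> trapped_surface r u v \<and> \<not> MOTS r u v"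

definition g :: "real \<Rightarrow> real \<Rightarrow> real" where
  "g \<omega> x = (1 + \<omega> / 2) / (1 - \<omega> / 2) * (1 / (1 + x)\<^sup>2)
     * ((2 powr (1 - \<omega> / 2) / \<omega> + 1 / (2 powr (1 + \<omega> / 2) * (1 + \<omega> / 2))) * x powr (1 - \<omega> / 2)
        - 2 / \<omega> * x - 1 / (1 + \<omega> / 2) * x\<^sup>2)"

end

theory Submission
  imports Defs
begin

text \<open>
  Suppose that no trapped surface forms. The Raychaudhuri equations and the normalization on the initial
  cones give \<open>\<partial>\<^sub>u r < 0 \<le> \<partial>\<^sub>v r\<close> on the rectangle, with \<open>- \<Omega>\<^sup>-\<^sup>2 \<partial>\<^sub>u r \<ge> (1 - \<epsilon>) / 2\<close>. On each slice of constant \<open>u\<close> the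
  smallness of \<open>v\<^sub>2 - v\<^sub>1\<close> bounds the increments of \<open>\<phi>\<close> and \<open>Q\<close> by that of the Hawking mass. Hence the slice
  stays undercharged, \<open>Q\<^sup>2 \<le> r m\<close>, the width \<open>r\<^sub>2 - r\<^sub>1\<close> decreases in \<open>u\<close>, and \<open>\<eta> = 2 (m\<^sub>2 - m\<^sub>1) / r\<^sub>2\<close> satisfies,
  as long as \<open>13 \<epsilon> \<le> \<omega> \<eta>\<close> and with \<open>x = r\<^sub>2(u) / r\<^sub>2(u\<^sub>0)\<close> and \<open>a = \<delta>\<^sub>0 / (1 + \<delta>\<^sub>0)\<close>,
  \<open>x \<eta>' + \<eta> \<le> a / (x - a) * ((1 + \<omega> / 2) / (1 - \<omega> / 2) + (1 + \<omega> / 2) \<eta>) + \<omega> / 2 * \<eta>\<close>.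
  The integrating factor \<open>x\<^sup>2 (x - a) powr - (1 + \<omega> / 2)\<close> is increasing for \<open>x \<ge> 3 a\<close> because \<open>\<omega> < 2 / 3\<close>; the
  source term integrates to \<open>g \<omega> \<delta>\<^sub>0\<close>. So \<open>13 \<epsilon> \<le> \<omega> \<eta>\<close> persists and \<open>\<eta> > 1\<close> at \<open>u\<^sub>s\<close>, whereas \<open>2 m \<le> r\<close>
  without trapped surfaces.
\<close>

section \<open>Smoothness up to the boundary and Cauchy--Schwarz bounds\<close>

lemma smooth_near_du: "smooth_near S f \<Longrightarrow> smooth_near S (du f)"
  unfolding smooth_near_def by (metis Ck_on.simps(2))

lemma smooth_near_dv: "smooth_near S f \<Longrightarrow> smooth_near S (dv f)"
  unfolding smooth_near_def by (metis Ck_on.simps(2))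

lemma smooth_near_isCont:
  assumes "smooth_near S f" "(u, v) \<in> S"
  shows "isCont (\<lambda>p. f (fst p) (snd p)) (u, v)"
proof -
  obtain U where "open U" "S \<subseteq> U" "Ck_on 0 U f"
    using assms(1) unfolding smooth_near_def by blast
  then show ?thesis
    using assms(2) by (auto simp: case_prod_beta continuous_on_eq_continuous_at)
qed

lemma smooth_near_has_du:
  assumes "smooth_near S f" "(u, v) \<in> S"
  shows "((\<lambda>s. f s v) has_vector_derivative du f u v) (at u)"
proof -
  obtain U where "S \<subseteq> U" "Ck_on (Suc 0) U f"
    using assms(1) unfolding smooth_near_def by blast
  then show ?thesis
    using assms(2) by (fastforce simp: du_def vector_derivative_works)
qed

lemma smooth_near_has_dv:
  assumes "smooth_near S f" "(u, v) \<in> S"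
  shows "((\<lambda>s. f u s) has_vector_derivative dv f u v) (at v)"
proof -
  obtain U where "S \<subseteq> U" "Ck_on (Suc 0) U f"
    using assms(1) unfolding smooth_near_def by blast
  then show ?thesis
    using assms(2) by (fastforce simp: dv_def vector_derivative_works)
qed

lemma has_dv_eq: "((\<lambda>s. f u s) has_vector_derivative D) (at v) \<Longrightarrow> dv f u v = D"
  by (simp add: dv_def vector_derivative_at)

lemma has_du_eq: "((\<lambda>s. f s v) has_vector_derivative D) (at u) \<Longrightarrow> du f u v = D"
  by (simp add: du_def vector_derivative_at)

text \<open>Schwarz's theorem: on a small square \<open>f\<close> is its value on the bottom edge
  plus the integral of \<open>dv f\<close>; differentiate under the integral in \<open>u\<close>,
  then in \<open>v\<close>. The mass equation in \<open>u\<close> and the equation for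
  \<open>r\<close> times \<open>gauge_du\<close> need mixed derivatives in the order opposite to
  that of the system.\<close>

lemma smooth_near_du_dv_commute:
  fixes f :: "real \<Rightarrow> real \<Rightarrow> 'a::banach"
  assumes "smooth_near S f" "(u, v) \<in> S"
  shows "du (dv f) u v = dv (du f) u v"
proof -
  obtain U where U: "open U" "S \<subseteq> U" and Ck: "\<And>k. Ck_on k U f"
    using assms(1) unfolding smooth_near_def by blast
  have sm: "smooth_near U f"
    using U Ck unfolding smooth_near_def by blast
  have "(u, v) \<in> U"
    using U assms(2) by blast
  then obtain d where d: "0 < d" "cball (u, v) d \<subseteq> U"
    using U(1) open_contains_cball by blast
  define c where "c = d / 2"
  have c: "0 < c" and box: "{u-c..u+c} \<times> {v-c..v+c} \<subseteq> U"
  proof -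
    show "0 < c" using d by (simp add: c_def)
    have "dist (u, v) (s, t) \<le> d" if "s \<in> {u-c..u+c}" "t \<in> {v-c..v+c}" for s t
    proof -
      have "dist (u, v) (s, t) \<le> \<bar>dist u s\<bar> + \<bar>dist v t\<bar>"
        unfolding dist_Pair_Pair by (rule sqrt_sum_squares_le_sum_abs)
      also have "\<dots> \<le> d"
        using that by (auto simp: dist_real_def c_def)
      finally show ?thesis .
    qed
    then show "{u-c..u+c} \<times> {v-c..v+c} \<subseteq> U"
      using d by (auto simp: mem_cball)
  qed
  have inU: "(s, t) \<in> U" if "s \<in> {u-c..u+c}" "t \<in> {v-c..v+c}" for s t
    using box that by blast
  have cont: "continuous_on {v-c..v+c} (\<lambda>t. h s t)" 
    if "smooth_near U h" "s \<in> {u-c..u+c}" for h :: "real \<Rightarrow> real \<Rightarrow> 'a" and s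
    by (intro continuous_at_imp_continuous_on ballI)
       (use smooth_near_has_dv[OF that(1) inU[OF that(2)]] in
         \<open>blast intro: has_vector_derivative_continuous\<close>)
  have ftc: "f s t = f s (v-c) + integral {v-c..t} (dv f s)"
    if s: "s \<in> {u-c..u+c}" and t: "t \<in> {v-c..v+c}" for s t
  proof -
    have "(dv f s has_integral f s t - f s (v-c)) {v-c..t}"
      by (rule fundamental_theorem_of_calculus)
         (use s t in \<open>auto intro!: has_vector_derivative_at_within[OF smooth_near_has_dv] sm inU\<close>)
    then show ?thesis
      by (simp add: integral_unique)
  qed
  have du_eq: "du f u t = du f u (v-c) + integral {v-c..t} (du (dv f) u)"
    if t: "t \<in> {v-c..v+c}" for t
  proof -
    have cj: "continuous_on ({u-c..u+c} \<times> cbox (v-c) t) (\<lambda>(x, y). du (dv f) x y)"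
    proof (intro continuous_at_imp_continuous_on ballI)
      fix p assume "p \<in> {u-c..u+c} \<times> cbox (v-c) t"
      then have "(fst p, snd p) \<in> U" using inU t by auto
      from smooth_near_isCont[OF smooth_near_du[OF smooth_near_dv[OF sm]] this]
      show "isCont (\<lambda>(x, y). du (dv f) x y) p" by (simp add: case_prod_beta')
    qed
    have "((\<lambda>s. integral (cbox (v-c) t) (dv f s)) has_vector_derivative
        integral (cbox (v-c) t) (du (dv f) u)) (at u within {u-c..u+c})"
    proof (rule leibniz_rule_vector_derivative[where f = "dv f" and fx = "du (dv f)"])
      show "((\<lambda>x. dv f x y) has_vector_derivative du (dv f) x y) (at x within {u-c..u+c})"
        if "x \<in> {u-c..u+c}" "y \<in> cbox (v-c) t" for x y
        using that t by (auto intro!: has_vector_derivative_at_within[OF smooth_near_has_du]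
          smooth_near_dv[OF sm] inU)
      show "dv f x integrable_on cbox (v-c) t" if "x \<in> {u-c..u+c}" for x
        using cont[OF smooth_near_dv[OF sm] that] t
        by (intro integrable_continuous) (auto intro: continuous_on_subset)
    qed (use c cj in auto)
    moreover have "((\<lambda>s. f s (v-c)) has_vector_derivative du f u (v-c)) (at u within {u-c..u+c})"
      by (rule has_vector_derivative_at_within[OF smooth_near_has_du[OF sm inU]]) (use c in auto)
    ultimately have "((\<lambda>s. f s (v-c) + integral {v-c..t} (dv f s)) has_vector_derivative
        du f u (v-c) + integral {v-c..t} (du (dv f) u)) (at u within {u-c..u+c})"
      by (simp add: has_vector_derivative_add)
    then have "((\<lambda>s. f s t) has_vector_derivative
        du f u (v-c) + integral {v-c..t} (du (dv f) u)) (at u within {u-c..u+c})"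
      by (rule has_vector_derivative_transform[rotated -1])
         (use c in simp, rule ftc[OF _ t])
    then have "((\<lambda>s. f s t) has_vector_derivative
        du f u (v-c) + integral {v-c..t} (du (dv f) u)) (at u)"
      using c by (simp add: at_within_Icc_at)
    then show ?thesis by (rule has_du_eq)
  qed
  have "((\<lambda>t. integral {v-c..t} (du (dv f) u)) has_vector_derivative du (dv f) u v)
      (at v within {v-c..v+c})"
    by (rule integral_has_vector_derivative)
       (use c cont[OF smooth_near_du[OF smooth_near_dv[OF sm]]] in auto)
  then have "((\<lambda>t. du f u (v-c) + integral {v-c..t} (du (dv f) u)) has_vector_derivative
      du (dv f) u v) (at v within {v-c..v+c})"
    by (auto intro: derivative_eq_intros)
  then have "((\<lambda>t. du f u t) has_vector_derivative du (dv f) u v) (at v within {v-c..v+c})"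
    by (rule has_vector_derivative_transform[rotated -1]) (use c in simp, rule du_eq)
  then have "((\<lambda>t. du f u t) has_vector_derivative du (dv f) u v) (at v)"
    using c by (simp add: at_within_Icc_at)
  then show ?thesis by (rule has_dv_eq[symmetric])
qed

text \<open>The right-hand side of \<open>le\<close> has infimum \<open>sqrt (p * q)\<close> over
  \<open>l > 0\<close>, attained at \<open>sqrt q / sqrt p\<close> when \<open>p\<close> and
  \<open>q\<close> are positive.\<close>

lemma square_le_mult_if_scaled_le:
  fixes n p q :: real
  assumes n: "0 \<le> n" and p: "0 \<le> p" and q: "0 \<le> q"
    and le: "\<And>l. 0 < l \<Longrightarrow> n \<le> (l * p + q / l) / 2"
  shows "n\<^sup>2 \<le> p * q"
proof (cases "p = 0 \<or> q = 0")
  case False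
  then have pq: "0 < p" "0 < q" using p q by auto
  define l where "l = sqrt q / sqrt p"
  have "l * p = sqrt p * sqrt q" "q / l = sqrt p * sqrt q"
    using pq by (simp_all add: l_def field_simps flip: power2_eq_square)
  then have "n \<le> sqrt (p * q)"
    using le[of l] pq by (simp add: l_def real_sqrt_mult)
  then have "n\<^sup>2 \<le> (sqrt (p * q))\<^sup>2" using n by (rule power_mono)
  then show ?thesis using pq by simp
next
  case True
  have "n = 0"
  proof (rule ccontr)
    assume "n \<noteq> 0"
    then have "0 < n" using n by simp
    \<comment> \<open>If one factor vanishes there need be no optimal \<open>l\<close>; taking
      \<open>q / n\<close> or \<open>n / p\<close> makes the surviving term exactly
      \<open>n / 2\<close>.\<close>
    have "n \<le> n / 2"
    proof (cases "p = 0")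
      case True
      show ?thesis
      proof (cases "q = 0")
        case False
        then show ?thesis using le[of "q / n"] \<open>0 < n\<close> q True by (simp add: field_simps)
      qed (use le[of 1] True \<open>0 < n\<close> in simp)
    next
      case False
      then show ?thesis using le[of "n / p"] \<open>0 < n\<close> p \<open>p = 0 \<or> q = 0\<close> by simp
    qed
    then show False using \<open>0 < n\<close> by simp
  qed
  then show ?thesis using True by auto
qed

text \<open>Cauchy--Schwarz for \<open>\<integral> X'\<close>, phrased through primitives so that no integral occurs.\<close>

lemma norm_increment_square_le:
  fixes X :: "real \<Rightarrow> 'a::real_normed_vector"
  assumes ab: "a < b"
    and X: "\<And>t. t \<in> {a..b} \<Longrightarrow> (X has_vector_derivative X' t) (at t)"
    and F: "\<And>t. t \<in> {a..b} \<Longrightarrow> (F has_real_derivative F' t) (at t)"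
    and G: "\<And>t. t \<in> {a..b} \<Longrightarrow> (G has_real_derivative G' t) (at t)"
    and le: "\<And>t. t \<in> {a..b} \<Longrightarrow> (norm (X' t))\<^sup>2 \<le> F' t * G' t"
    and F': "\<And>t. t \<in> {a..b} \<Longrightarrow> 0 \<le> F' t" and G': "\<And>t. t \<in> {a..b} \<Longrightarrow> 0 \<le> G' t"
  shows "(norm (X b - X a))\<^sup>2 \<le> (F b - F a) * (G b - G a)"
proof (rule square_le_mult_if_scaled_le)
  show "0 \<le> F b - F a"
    using DERIV_nonneg_imp_nondecreasing[of a b F] ab F F' by (meson atLeastAtMost_iff diff_ge_0_iff_ge less_imp_le)
  show "0 \<le> G b - G a"
    using DERIV_nonneg_imp_nondecreasing[of a b G] ab G G' by (meson atLeastAtMost_iff diff_ge_0_iff_ge less_imp_le)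
  \<comment> \<open>For each fixed \<open>l\<close> the arithmetic-geometric mean lets
    \<open>(l * F' + G' / l) / 2\<close> dominate the norm of \<open>X'\<close>, so the mean value
    inequality applies; \<open>l\<close> is optimized only afterwards.\<close>
  fix l :: real assume l: "0 < l"
  have H: "((\<lambda>t. (l * F t + G t / l) / 2) has_real_derivative (l * F' t + G' t / l) / 2) (at t)"
    if "t \<in> {a..b}" for t
    using l by (auto intro!: derivative_eq_intros F[OF that] G[OF that])
  have "norm (X b - X a) \<le> (l * F b + G b / l) / 2 - (l * F a + G a / l) / 2"
  proof (rule differentiable_bound_general[OF ab])
    show "continuous_on {a..b} X"
      by (intro continuous_at_imp_continuous_on ballI) (blast intro: has_vector_derivative_continuous X)
    show "continuous_on {a..b} (\<lambda>t. (l * F t + G t / l) / 2)"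
      by (intro continuous_at_imp_continuous_on ballI) (blast intro: DERIV_isCont H)
    fix t assume "a < t" "t < b"
    then have t: "t \<in> {a..b}" by simp
    show "(X has_vector_derivative X' t) (at t)" by (rule X[OF t])
    show "((\<lambda>t. (l * F t + G t / l) / 2) has_vector_derivative (l * F' t + G' t / l) / 2) (at t)"
      using H[OF t] by (simp add: has_real_derivative_iff_has_vector_derivative)
    have "norm (X' t) \<le> sqrt ((l * F' t) * (G' t / l))"
      using le[OF t] l by (intro real_le_rsqrt) simp
    also have "\<dots> \<le> (l * F' t + G' t / l) / 2"
      using l F'[OF t] G'[OF t] by (intro arith_geo_mean_sqrt) simp_all
    finally show "norm (X' t) \<le> (l * F' t + G' t / l) / 2" .
  qed
  then show "norm (X b - X a) \<le> (l * (F b - F a) + (G b - G a) / l) / 2"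
    by (simp add: algebra_simps diff_divide_distrib add_divide_distrib)
qed simp

section \<open>Estimates on an outgoing slice\<close>

text \<open>Young's inequality: after the triangle inequality the defect is
  \<open>(c * norm a - norm b)\<^sup>2 / c\<close>. The weight \<open>c\<close> is later 1,
  \<open>\<omega> / 4\<close> and \<open>\<eta>'\<close>.\<close>

lemma norm_add_square_le:
  fixes a b :: "'a::real_normed_vector"
  assumes "0 < c"
  shows "(norm (a + b))\<^sup>2 \<le> (1 + c) * (norm a)\<^sup>2 + (1 + 1 / c) * (norm b)\<^sup>2"
proof -
  have "(norm (a + b))\<^sup>2 \<le> (norm a + norm b)\<^sup>2"
    by (intro power_mono norm_triangle_ineq norm_ge_zero)
  also have "\<dots> = (1 + c) * (norm a)\<^sup>2 + (1 + 1 / c) * (norm b)\<^sup>2 - (c * norm a - norm b)\<^sup>2 / c"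
    using assms by (simp add: field_simps power2_eq_square)
  also have "\<dots> \<le> (1 + c) * (norm a)\<^sup>2 + (1 + 1 / c) * (norm b)\<^sup>2"
    using assms by simp
  finally show ?thesis .
qed

text \<open>
  A slice \<open>{u} \<times> [v\<^sub>1, v\<^sub>2]\<close> with \<open>W = \<Omega>\<^sup>2\<close>, \<open>z = \<Omega>\<^sup>-\<^sup>2 \<partial>\<^sub>v r\<close>, \<open>n = - \<partial>\<^sub>u r\<close>, \<open>\<phi>' = \<partial>\<^sub>v \<phi>\<close> and \<open>X = r D\<^sub>u \<phi>\<close>.
\<close>

locale null_slice =
  fixes e \<epsilon> \<omega> v\<^sub>1 v\<^sub>2 :: real
    and r m Q W z n :: "real \<Rightarrow> real"
    and \<phi> \<phi>' X :: "real \<Rightarrow> complex"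
  assumes v12: "v\<^sub>1 < v\<^sub>2" and \<omega>: "0 < \<omega>" "\<omega> < 2 / 3" and \<epsilon>: "0 \<le> \<epsilon>" "\<epsilon> < 1"
    and r_pos: "\<And>v. v \<in> {v\<^sub>1..v\<^sub>2} \<Longrightarrow> 0 < r v"
    and W_pos: "\<And>v. v \<in> {v\<^sub>1..v\<^sub>2} \<Longrightarrow> 0 < W v"
    and z_nonneg: "\<And>v. v \<in> {v\<^sub>1..v\<^sub>2} \<Longrightarrow> 0 \<le> z v"
    and n_ge: "\<And>v. v \<in> {v\<^sub>1..v\<^sub>2} \<Longrightarrow> (1 - \<epsilon>) / 2 * W v \<le> n v"
    and m_eq: "\<And>v. v \<in> {v\<^sub>1..v\<^sub>2} \<Longrightarrow> 2 * m v = r v * (1 - 4 * n v * z v)"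
    and r_deriv: "\<And>v. v \<in> {v\<^sub>1..v\<^sub>2} \<Longrightarrow> (r has_real_derivative W v * z v) (at v)"
    and z_deriv: "\<And>v. v \<in> {v\<^sub>1..v\<^sub>2} \<Longrightarrow>
      (z has_real_derivative - (4 * pi * r v / W v * (cmod (\<phi>' v))\<^sup>2)) (at v)"
    and m_deriv: "\<And>v. v \<in> {v\<^sub>1..v\<^sub>2} \<Longrightarrow>
      (m has_real_derivative 8 * pi * (r v)\<^sup>2 * (n v / W v) * (cmod (\<phi>' v))\<^sup>2
        + W v * z v * ((Q v)\<^sup>2 / (2 * (r v)\<^sup>2))) (at v)"
    and n_deriv: "\<And>v. v \<in> {v\<^sub>1..v\<^sub>2} \<Longrightarrow>
      (n has_real_derivative W v / (4 * (r v)\<^sup>2) * (2 * m v - (Q v)\<^sup>2 / r v)) (at v)"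
    and Q_deriv: "\<And>v. v \<in> {v\<^sub>1..v\<^sub>2} \<Longrightarrow>
      (Q has_real_derivative - (4 * pi * e * (r v)\<^sup>2 * Im (cnj (\<phi> v) * \<phi>' v))) (at v)"
    and \<phi>_deriv: "\<And>v. v \<in> {v\<^sub>1..v\<^sub>2} \<Longrightarrow> (\<phi> has_vector_derivative \<phi>' v) (at v)"
    and X_deriv: "\<And>v. v \<in> {v\<^sub>1..v\<^sub>2} \<Longrightarrow>
      (X has_vector_derivative of_real (n v) * \<phi>' v
        - \<i> * of_real (e * W v * Q v / (4 * r v)) * \<phi> v) (at v)"
    and m1_ge: "\<bar>Q v\<^sub>1\<bar> \<le> m v\<^sub>1" and Q1_le: "(Q v\<^sub>1)\<^sup>2 \<le> \<epsilon> * (r v\<^sub>1)\<^sup>2"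
    and r2_le: "r v\<^sub>2 \<le> 3 / 2 * r v\<^sub>1"
    and small1: "9 * e\<^sup>2 / (4 * (1 - \<epsilon>)\<^sup>2) * (v\<^sub>2 - v\<^sub>1)\<^sup>2
      + 12 * pi * (r v\<^sub>1 * (cmod (\<phi> v\<^sub>1))\<^sup>2) * e\<^sup>2 / (1 - \<epsilon>) * (v\<^sub>2 - v\<^sub>1) \<le> \<omega> / 4"
    and small2: "45 * e\<^sup>2 * (v\<^sub>2 - v\<^sub>1)\<^sup>2 / (1 - \<epsilon>)\<^sup>2
      + 160 * pi * e\<^sup>2 * r v\<^sub>2 * ((v\<^sub>2 - v\<^sub>1) / (1 - \<epsilon>)) * (cmod (\<phi> v\<^sub>1))\<^sup>2 \<le> 4 * \<omega>"
begin

section \<open>Monotonicity on a slice, and control of \<phi> and \<open>Q\<close> by the mass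
  increment\<close>

lemma v1_mem: "v\<^sub>1 \<in> {v\<^sub>1..v\<^sub>2}" and v2_mem: "v\<^sub>2 \<in> {v\<^sub>1..v\<^sub>2}"
  using v12 by auto

lemma r_mono: "v\<^sub>1 \<le> s \<Longrightarrow> s \<le> t \<Longrightarrow> t \<le> v\<^sub>2 \<Longrightarrow> r s \<le> r t"
  by (rule DERIV_nonneg_imp_nondecreasing)
     (auto intro!: exI conjI r_deriv mult_nonneg_nonneg z_nonneg less_imp_le[OF W_pos])

lemma n_pos: "v \<in> {v\<^sub>1..v\<^sub>2} \<Longrightarrow> 0 < n v"
  using n_ge[of v] W_pos[of v] \<epsilon> by (smt (verit) mult_pos_pos divide_pos_pos)

definition m' :: "real \<Rightarrow> real" where
  "m' v = 8 * pi * (r v)\<^sup>2 * (n v / W v) * (cmod (\<phi>' v))\<^sup>2 + W v * z v * ((Q v)\<^sup>2 / (2 * (r v)\<^sup>2))"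

lemma m'_deriv: "v \<in> {v\<^sub>1..v\<^sub>2} \<Longrightarrow> (m has_real_derivative m' v) (at v)"
  unfolding m'_def by (rule m_deriv)

lemma kinetic_le_m':
  assumes "v \<in> {v\<^sub>1..v\<^sub>2}"
  shows "8 * pi * (r v)\<^sup>2 * (n v / W v) * (cmod (\<phi>' v))\<^sup>2 \<le> m' v"
  unfolding m'_def using W_pos[OF assms] z_nonneg[OF assms] by simp

lemma m'_nonneg:
  assumes "v \<in> {v\<^sub>1..v\<^sub>2}" shows "0 \<le> m' v"
  using kinetic_le_m'[OF assms] W_pos[OF assms] n_pos[OF assms]
  by (smt (verit) divide_nonneg_nonneg mult_nonneg_nonneg pi_ge_zero zero_le_power2)

text \<open>The bound \<open>n_ge\<close> trades the weight \<open>n / W\<close> for the constant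
  \<open>(1 - \<epsilon>) / 2\<close>, so that the mass increment alone controls the kinetic
  energy.\<close>

lemma kinetic_le_m'2:
  assumes "v \<in> {v\<^sub>1..v\<^sub>2}"
  shows "4 * pi * (1 - \<epsilon>) * (r v)\<^sup>2 * (cmod (\<phi>' v))\<^sup>2 \<le> m' v"
proof -
  have "(1 - \<epsilon>) / 2 \<le> n v / W v"
    using n_ge[OF assms] W_pos[OF assms] by (simp add: pos_le_divide_eq)
  then have "8 * pi * (r v)\<^sup>2 * ((1 - \<epsilon>) / 2) * (cmod (\<phi>' v))\<^sup>2
      \<le> 8 * pi * (r v)\<^sup>2 * (n v / W v) * (cmod (\<phi>' v))\<^sup>2"
    by (intro mult_right_mono mult_left_mono) auto
  also note kinetic_le_m'[OF assms]
  finally show ?thesis by simp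
qed

lemma m_mono: "v\<^sub>1 \<le> s \<Longrightarrow> s \<le> t \<Longrightarrow> t \<le> v\<^sub>2 \<Longrightarrow> m s \<le> m t"
  by (rule DERIV_nonneg_imp_nondecreasing) (auto intro!: exI conjI m'_deriv m'_nonneg)

lemma two_m_le:
  assumes "v \<in> {v\<^sub>1..v\<^sub>2}" shows "2 * m v \<le> r v"
proof -
  have "0 \<le> r v * (4 * n v * z v)"
    using r_pos[OF assms] n_pos[OF assms] z_nonneg[OF assms] by simp
  then show ?thesis using m_eq[OF assms] by (simp add: algebra_simps)
qed

lemma m1_nonneg: "0 \<le> m v\<^sub>1"
  using m1_ge by linarith

text \<open>Cauchy--Schwarz against the density \<open>m'\<close>: the remaining factor
  \<open>1 / r\<^sup>2\<close> is largest at \<open>v\<^sub>1\<close>. Young's inequality with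
  weight 1 then separates the initial value from the increment.\<close>

lemma \<phi>_square_le:
  assumes v: "v \<in> {v\<^sub>1..v\<^sub>2}"
  shows "(cmod (\<phi> v))\<^sup>2 \<le> 2 * (cmod (\<phi> v\<^sub>1))\<^sup>2
    + (m v - m v\<^sub>1) * (v\<^sub>2 - v\<^sub>1) / (2 * pi * (1 - \<epsilon>) * (r v\<^sub>1)\<^sup>2)"
proof -
  let ?k = "4 * pi * (1 - \<epsilon>) * (r v\<^sub>1)\<^sup>2"
  have k: "0 < ?k" using \<epsilon> r_pos[OF v1_mem] by simp
  have dm: "0 \<le> m v - m v\<^sub>1" using m_mono[of v\<^sub>1 v] v by simp
  have "(cmod (\<phi> v - \<phi> v\<^sub>1))\<^sup>2 \<le> (m v - m v\<^sub>1) * (v / ?k - v\<^sub>1 / ?k)" if "v\<^sub>1 < v"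
  proof (rule norm_increment_square_le[OF that])
    fix t assume "t \<in> {v\<^sub>1..v}"
    then have t: "t \<in> {v\<^sub>1..v\<^sub>2}" using v by auto
    show "(\<phi> has_vector_derivative \<phi>' t) (at t)" by (rule \<phi>_deriv[OF t])
    show "(m has_real_derivative m' t) (at t)" by (rule m'_deriv[OF t])
    show "((\<lambda>t. t / ?k) has_real_derivative 1 / ?k) (at t)"
      using k by (auto intro!: derivative_eq_intros)
    show "0 \<le> m' t" by (rule m'_nonneg[OF t])
    have "?k * (cmod (\<phi>' t))\<^sup>2 \<le> 4 * pi * (1 - \<epsilon>) * (r t)\<^sup>2 * (cmod (\<phi>' t))\<^sup>2"
      using r_mono[of v\<^sub>1 t] r_pos[OF v1_mem] t \<epsilon>
      by (intro mult_right_mono mult_left_mono power_mono) auto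
    also note kinetic_le_m'2[OF t]
    finally show "(cmod (\<phi>' t))\<^sup>2 \<le> m' t * (1 / ?k)"
      using k by (simp add: pos_le_divide_eq mult_ac)
    show "0 \<le> 1 / ?k" using k by simp
  qed
  then have "(cmod (\<phi> v - \<phi> v\<^sub>1))\<^sup>2 \<le> (m v - m v\<^sub>1) * (v / ?k - v\<^sub>1 / ?k)"
    using v by (cases "v = v\<^sub>1") auto
  also have "\<dots> \<le> (m v - m v\<^sub>1) * ((v\<^sub>2 - v\<^sub>1) / ?k)"
    using dm k v by (intro mult_left_mono) (auto simp: divide_right_mono simp flip: diff_divide_distrib)
  finally have "(cmod (\<phi> v - \<phi> v\<^sub>1))\<^sup>2 \<le> (m v - m v\<^sub>1) * ((v\<^sub>2 - v\<^sub>1) / ?k)" .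
  moreover have "(cmod (\<phi> v))\<^sup>2 \<le> 2 * (cmod (\<phi> v\<^sub>1))\<^sup>2 + 2 * (cmod (\<phi> v - \<phi> v\<^sub>1))\<^sup>2"
    using norm_add_square_le[of 1 "\<phi> v\<^sub>1" "\<phi> v - \<phi> v\<^sub>1"] by simp
  moreover have "2 * ((m v - m v\<^sub>1) * ((v\<^sub>2 - v\<^sub>1) / ?k))
      = (m v - m v\<^sub>1) * (v\<^sub>2 - v\<^sub>1) / (2 * pi * (1 - \<epsilon>) * (r v\<^sub>1)\<^sup>2)"
    using k by (simp add: divide_simps)
  ultimately show ?thesis by linarith
qed

text \<open>By Maxwell's equation \<open>Q'\<close> is bounded by
  \<open>r\<^sup>2 |\<phi>| |\<phi>'|\<close>, up to a constant. Cauchy--Schwarz puts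
  \<open>r |\<phi>'|\<close> into the mass increment, and \<open>small1\<close> makes the remaining
  factor at most \<open>\<omega> / 4 * r v\<close>.\<close>

lemma Q_increment_square_le:
  assumes v: "v \<in> {v\<^sub>1..v\<^sub>2}"
  shows "(Q v - Q v\<^sub>1)\<^sup>2 \<le> \<omega> / 4 * r v * (m v - m v\<^sub>1)"
proof (cases "v = v\<^sub>1")
  case False
  then have v1v: "v\<^sub>1 < v" using v by simp
  define D where "D = v\<^sub>2 - v\<^sub>1"
  define \<kappa> where "\<kappa> = 1 - \<epsilon>"
  \<comment> \<open>\<open>\<Phi>\<close> bounds the square of the field on all of
    \<open>[v\<^sub>1, v]\<close>, and \<open>k\<close> is the resulting constant density with
    \<open>(Q')\<^sup>2 \<le> m' * k\<close>.\<close>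
  define \<Phi> where "\<Phi> = 2 * (cmod (\<phi> v\<^sub>1))\<^sup>2 + (m v - m v\<^sub>1) * D / (2 * pi * \<kappa> * (r v\<^sub>1)\<^sup>2)"
  define k where "k = 4 * pi * e\<^sup>2 / \<kappa> * (r v)\<^sup>2 * \<Phi>"
  have D: "0 < D" and \<kappa>: "0 < \<kappa>" and r1: "0 < r v\<^sub>1" and rv: "0 < r v"
    using v12 \<epsilon> r_pos v v1_mem by (auto simp: D_def \<kappa>_def)
  have dm: "0 \<le> m v - m v\<^sub>1" using m_mono[of v\<^sub>1 v] v by simp
  have \<Phi>0: "0 \<le> \<Phi>" unfolding \<Phi>_def using D \<kappa> dm by simp
  have k0: "0 \<le> k" unfolding k_def using \<kappa> \<Phi>0 by simp
  have "(norm (Q v - Q v\<^sub>1))\<^sup>2 \<le> (m v - m v\<^sub>1) * (k * v - k * v\<^sub>1)"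
  proof (rule norm_increment_square_le[OF v1v])
    fix t assume "t \<in> {v\<^sub>1..v}"
    then have t: "t \<in> {v\<^sub>1..v\<^sub>2}" "t \<le> v" using v by auto
    show "(Q has_vector_derivative - (4 * pi * e * (r t)\<^sup>2 * Im (cnj (\<phi> t) * \<phi>' t))) (at t)"
      using Q_deriv[OF t(1)] by (simp add: has_real_derivative_iff_has_vector_derivative)
    show "(m has_real_derivative m' t) (at t)" by (rule m'_deriv[OF t(1)])
    show "((\<lambda>t. k * t) has_real_derivative k) (at t)"
      by (auto intro!: derivative_eq_intros)
    show "0 \<le> m' t" by (rule m'_nonneg[OF t(1)])
    have m_le: "m t \<le> m v" using m_mono[of t v] t v by simp
    have "(cmod (\<phi> t))\<^sup>2 \<le> 2 * (cmod (\<phi> v\<^sub>1))\<^sup>2 + (m t - m v\<^sub>1) * D / (2 * pi * \<kappa> * (r v\<^sub>1)\<^sup>2)"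
      using \<phi>_square_le[OF t(1)] by (simp add: D_def \<kappa>_def)
    also have "\<dots> \<le> \<Phi>"
      unfolding \<Phi>_def using m_le D \<kappa> by (intro add_left_mono divide_right_mono mult_right_mono) auto
    finally have \<phi>_le: "(cmod (\<phi> t))\<^sup>2 \<le> \<Phi>" .
    have kin: "(r t)\<^sup>2 * (cmod (\<phi>' t))\<^sup>2 \<le> m' t / (4 * pi * \<kappa>)"
      using kinetic_le_m'2[OF t(1)] \<kappa> by (simp add: \<kappa>_def pos_le_divide_eq mult_ac)
    have "(norm (- (4 * pi * e * (r t)\<^sup>2 * Im (cnj (\<phi> t) * \<phi>' t))))\<^sup>2
        = 16 * pi\<^sup>2 * e\<^sup>2 * (r t)^4 * \<bar>Im (cnj (\<phi> t) * \<phi>' t)\<bar>\<^sup>2"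
      by (simp add: power_mult_distrib flip: power_mult)
    also have "\<dots> \<le> 16 * pi\<^sup>2 * e\<^sup>2 * (r t)^4 * (cmod (cnj (\<phi> t) * \<phi>' t))\<^sup>2"
      by (intro mult_left_mono power_mono abs_Im_le_cmod) auto
    also have "\<dots> = 16 * pi\<^sup>2 * e\<^sup>2 * (r t)\<^sup>2 * (cmod (\<phi> t))\<^sup>2 * ((r t)\<^sup>2 * (cmod (\<phi>' t))\<^sup>2)"
      by (simp add: norm_mult power_mult_distrib mult_ac power2_eq_square power4_eq_xxxx)
    also have "\<dots> \<le> 16 * pi\<^sup>2 * e\<^sup>2 * (r v)\<^sup>2 * \<Phi> * (m' t / (4 * pi * \<kappa>))"
      using kin \<phi>_le \<Phi>0 r_mono[of t v] r_pos[OF t(1)] t v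
      by (intro mult_mono power_mono order_refl) auto
    also have "\<dots> = m' t * k"
      using \<kappa> by (simp add: k_def field_simps power2_eq_square)
    finally show "(norm (- (4 * pi * e * (r t)\<^sup>2 * Im (cnj (\<phi> t) * \<phi>' t))))\<^sup>2 \<le> m' t * k" .
  qed (rule k0)
  also have "k * v - k * v\<^sub>1 \<le> k * D"
    using k0 v by (simp add: D_def mult_left_mono flip: right_diff_distrib)
  then have "(m v - m v\<^sub>1) * (k * v - k * v\<^sub>1) \<le> (m v - m v\<^sub>1) * (k * D)"
    using dm by (rule mult_left_mono)
  \<comment> \<open>The coefficients become those of \<open>small1\<close>:
    \<open>r v \<le> 3 / 2 * r v\<^sub>1\<close> turns \<open>8 * pi\<close> into
    \<open>12 * pi\<close>, and together with \<open>2 * (m v - m v\<^sub>1) \<le> r v\<close> it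
    yields the factor \<open>9 / 4\<close>.\<close>
  also have "k * D \<le> \<omega> / 4 * r v"
  proof -
    have rv_le: "r v \<le> 3 / 2 * r v\<^sub>1" using r_mono[of v v\<^sub>2] r2_le v by simp
    have "2 * (m v - m v\<^sub>1) \<le> r v" using two_m_le[OF v] m1_nonneg by simp
    then have "2 * (m v - m v\<^sub>1) * r v \<le> (r v)\<^sup>2"
      using rv by (simp add: power2_eq_square mult_right_mono)
    also have "\<dots> \<le> (3 / 2 * r v\<^sub>1)\<^sup>2" using rv_le rv by (intro power_mono) auto
    finally have mr: "2 * (m v - m v\<^sub>1) * r v / (r v\<^sub>1)\<^sup>2 \<le> 9 / 4"
      using r1 by (simp add: field_simps power2_eq_square)
    have "k * D = r v * (8 * pi * (r v * (cmod (\<phi> v\<^sub>1))\<^sup>2) * e\<^sup>2 / \<kappa> * D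
        + e\<^sup>2 / \<kappa>\<^sup>2 * D\<^sup>2 * (2 * (m v - m v\<^sub>1) * r v / (r v\<^sub>1)\<^sup>2))"
      using \<kappa> r1 by (simp add: k_def \<Phi>_def field_simps power2_eq_square)
    also have "\<dots> \<le> r v * (8 * pi * (3 / 2 * r v\<^sub>1 * (cmod (\<phi> v\<^sub>1))\<^sup>2) * e\<^sup>2 / \<kappa> * D
        + e\<^sup>2 / \<kappa>\<^sup>2 * D\<^sup>2 * (9 / 4))"
      using rv rv_le mr \<kappa> D
      by (intro mult_left_mono add_mono mult_right_mono divide_right_mono) auto
    also have "\<dots> \<le> r v * (\<omega> / 4)"
      using small1 rv by (intro mult_left_mono) (auto simp: D_def \<kappa>_def)
    finally show ?thesis by (simp add: mult_ac)
  qed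
  then have "(m v - m v\<^sub>1) * (k * D) \<le> (m v - m v\<^sub>1) * (\<omega> / 4 * r v)"
    using dm by (rule mult_left_mono)
  finally show ?thesis by (simp add: mult_ac)
qed simp

lemma Q_square_le:
  assumes v: "v \<in> {v\<^sub>1..v\<^sub>2}"
  shows "(Q v)\<^sup>2 \<le> 2 * (Q v\<^sub>1)\<^sup>2 + \<omega> / 2 * r v * (m v - m v\<^sub>1)"
  using Q_increment_square_le[OF v] norm_add_square_le[of 1 "Q v\<^sub>1" "Q v - Q v\<^sub>1"]
  by simp

text \<open>Undercharging propagates along the slice: at \<open>v\<^sub>1\<close> it gives
  \<open>2 * Q\<^sup>2 \<le> 2 * m\<^sup>2 \<le> r * m\<close>, and the charge created later uses at
  most the fraction \<open>\<omega> / 2 < 1\<close> of the mass added.\<close>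

lemma Q_square_le_mass:
  assumes v: "v \<in> {v\<^sub>1..v\<^sub>2}"
  shows "(Q v)\<^sup>2 \<le> r v * m v"
proof -
  have dm: "0 \<le> m v - m v\<^sub>1" using m_mono[of v\<^sub>1 v] v by simp
  have r1: "r v\<^sub>1 \<le> r v" using r_mono[of v\<^sub>1 v] v by simp
  have "(Q v\<^sub>1)\<^sup>2 \<le> (m v\<^sub>1)\<^sup>2"
    using m1_ge by (simp add: abs_le_square_iff[symmetric])
  also have "\<dots> \<le> m v\<^sub>1 * (r v / 2)"
    unfolding power2_eq_square using two_m_le[OF v1_mem] r1 m1_nonneg by (intro mult_left_mono) auto
  finally have "2 * (Q v\<^sub>1)\<^sup>2 \<le> r v * m v\<^sub>1" by (simp add: mult_ac)
  moreover have "\<omega> / 2 * (r v * (m v - m v\<^sub>1)) \<le> 1 * (r v * (m v - m v\<^sub>1))"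
    using \<omega> dm r_pos[OF v] by (intro mult_right_mono) auto
  moreover have "r v * m v = r v * m v\<^sub>1 + 1 * (r v * (m v - m v\<^sub>1))"
    by (simp add: right_diff_distrib)
  ultimately show ?thesis
    using Q_square_le[OF v] unfolding mult.assoc[of _ "r v"] by linarith
qed

text \<open>The sign of the derivative is that of \<open>2 * m - Q\<^sup>2 / r\<close>, which is at
  least \<open>m \<ge> 0\<close>. This makes the width \<open>r\<^sub>2 - r\<^sub>1\<close> shrink
  in \<open>u\<close>, and lets \<open>n v\<^sub>2\<close> dominate \<open>n\<close> on the
  slice.\<close>

lemma n_mono:
  assumes "v\<^sub>1 \<le> s" "s \<le> t" "t \<le> v\<^sub>2"
  shows "n s \<le> n t"
proof (rule DERIV_nonneg_imp_nondecreasing[OF assms(2)])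
  fix v assume "s \<le> v" "v \<le> t"
  then have v: "v \<in> {v\<^sub>1..v\<^sub>2}" using assms by auto
  have "0 \<le> m v" using m1_nonneg m_mono[of v\<^sub>1 v] v by auto
  moreover have "(Q v)\<^sup>2 / r v \<le> m v"
    using Q_square_le_mass[OF v] r_pos[OF v] by (simp add: field_simps)
  ultimately have "0 \<le> W v / (4 * (r v)\<^sup>2) * (2 * m v - (Q v)\<^sup>2 / r v)"
    using W_pos[OF v] by (intro mult_nonneg_nonneg) auto
  then show "\<exists>y. (n has_real_derivative y) (at v) \<and> 0 \<le> y"
    using n_deriv[OF v] by blast
qed

text \<open>
  Apart from a charge term with a favourable sign, the left-hand side is \<open>- \<partial>\<^sub>u (m\<^sub>2 - m\<^sub>1)\<close>. Its first part is
  controlled by the increment of \<open>X\<close> across the slice, because \<open>z v\<^sub>1 / z v\<^sub>2 \<ge> 1 + (1 - \<omega> / 2) \<eta>\<close>.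
\<close>

lemma flux_le:
  defines "\<delta> \<equiv> r v\<^sub>2 / r v\<^sub>1 - 1" and "\<eta> \<equiv> 2 * (m v\<^sub>2 - m v\<^sub>1) / r v\<^sub>2"
  assumes \<epsilon>\<eta>: "13 * \<epsilon> \<le> \<omega> * \<eta>" and \<eta>: "0 < \<eta>"
  shows "8 * pi * (z v\<^sub>2 * (cmod (X v\<^sub>2))\<^sup>2 - z v\<^sub>1 * (cmod (X v\<^sub>1))\<^sup>2) + n v\<^sub>2 * (Q v\<^sub>2)\<^sup>2 / (2 * (r v\<^sub>2)\<^sup>2)
    \<le> n v\<^sub>2 / 2 * (\<delta> * ((1 + \<omega> / 2) / (1 - \<omega> / 2) + (1 + \<omega> / 2) * \<eta>) + \<omega> / 2 * \<eta>)"
proof -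
  define r1 r2 \<Delta> where "r1 = r v\<^sub>1" and "r2 = r v\<^sub>2" and "\<Delta> = m v\<^sub>2 - m v\<^sub>1"
  \<comment> \<open>\<open>B\<close> bounds \<open>Q\<^sup>2\<close> on the slice. Its constant is
    \<open>21 / 52 = 2 / 13 + 1 / 4\<close>: twice the initial charge, estimated by
    \<open>13 * \<epsilon> \<le> \<omega> * \<eta>\<close>, plus the increment.\<close>
  define D \<kappa> B where "D = v\<^sub>2 - v\<^sub>1" and "\<kappa> = 1 - \<epsilon>" and "B = 21 / 52 * \<omega> * \<eta> * r2\<^sup>2"
  define \<Phi> where "\<Phi> = 2 * (cmod (\<phi> v\<^sub>1))\<^sup>2 + \<Delta> * D / (2 * pi * \<kappa> * r1\<^sup>2)"
  have D: "0 < D" and \<kappa>: "0 < \<kappa>" and r1: "0 < r1" and r2: "0 < r2"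
    using v12 \<epsilon> r_pos v1_mem v2_mem by (auto simp: D_def \<kappa>_def r1_def r2_def)
  have r12: "r1 \<le> r2" using r_mono v12 by (simp add: r1_def r2_def)
  have r2_le: "r2 \<le> 3 / 2 * r1" using r2_le by (simp add: r1_def r2_def)
  have \<Delta>_eq: "\<Delta> = r2 * \<eta> / 2" using r2 by (simp add: \<eta>_def \<Delta>_def r2_def)
  have \<delta>0: "0 \<le> \<delta>" and \<delta>_le: "\<delta> \<le> 1 / 2"
    using r12 r1 r2_le by (simp_all add: \<delta>_def flip: r1_def r2_def) (simp_all add: field_simps)
  have \<Delta>0: "0 < \<Delta>" using \<eta> r2 by (simp add: \<Delta>_eq)
  have \<eta>1: "\<eta> \<le> 1"
    using two_m_le[OF v2_mem] m1_nonneg r2 by (simp add: \<eta>_def r2_def field_simps)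
  have B0: "0 \<le> B" using \<omega> \<eta> by (simp add: B_def)
  have \<Phi>0: "0 \<le> \<Phi>" using D \<kappa> \<Delta>0 by (simp add: \<Phi>_def)
  have n2: "0 < n v\<^sub>2" by (rule n_pos[OF v2_mem])
  have Q_le: "(Q v)\<^sup>2 \<le> B" if v: "v \<in> {v\<^sub>1..v\<^sub>2}" for v
  proof -
    have m_le: "m v - m v\<^sub>1 \<le> \<Delta>" "0 \<le> m v - m v\<^sub>1"
      using m_mono[of v v\<^sub>2] m_mono[of v\<^sub>1 v] v by (simp_all add: \<Delta>_def)
    have rv: "0 < r v" "r v \<le> r2" using r_pos[OF v] r_mono[of v v\<^sub>2] v by (simp_all add: r2_def)
    have "(Q v\<^sub>1)\<^sup>2 \<le> \<epsilon> * r1\<^sup>2" using Q1_le by (simp add: r1_def)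
    also have "\<dots> \<le> \<epsilon> * r2\<^sup>2" using r12 r1 \<epsilon> by (intro mult_left_mono power_mono) auto
    also have "\<dots> \<le> \<omega> * \<eta> / 13 * r2\<^sup>2" using \<epsilon>\<eta> by (intro mult_right_mono) auto
    finally have "(Q v\<^sub>1)\<^sup>2 \<le> \<omega> * \<eta> / 13 * r2\<^sup>2" .
    moreover have "\<omega> / 2 * r v * (m v - m v\<^sub>1) \<le> \<omega> / 2 * r2 * \<Delta>"
      using \<omega> rv m_le by (intro mult_mono) auto
    moreover have "\<omega> / 2 * r2 * \<Delta> = \<omega> * \<eta> / 4 * r2\<^sup>2"
      by (simp add: \<Delta>_eq power2_eq_square)
    moreover have "B = 2 * (\<omega> * \<eta> / 13 * r2\<^sup>2) + \<omega> * \<eta> / 4 * r2\<^sup>2"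
      by (simp add: B_def)
    ultimately show ?thesis using Q_square_le[OF v] by linarith
  qed
  have flux: "8 * pi * (z v\<^sub>2 * (cmod (X v\<^sub>2))\<^sup>2 - z v\<^sub>1 * (cmod (X v\<^sub>1))\<^sup>2)
      \<le> n v\<^sub>2 / 2 * (\<delta> * ((1 + \<omega> / 2) / (1 - \<omega> / 2) + (1 + \<omega> / 2) * \<eta>))"
  proof (cases "z v\<^sub>2 = 0")
    \<comment> \<open>Here the flux through \<open>v\<^sub>2\<close> vanishes and the left side has
      a sign; the other case divides by \<open>z v\<^sub>2\<close>.\<close>
    case True
    have "0 \<le> z v\<^sub>1 * (cmod (X v\<^sub>1))\<^sup>2"
      using z_nonneg[OF v1_mem] by simp
    then have "8 * pi * (z v\<^sub>2 * (cmod (X v\<^sub>2))\<^sup>2 - z v\<^sub>1 * (cmod (X v\<^sub>1))\<^sup>2) \<le> 0"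
      using True by (intro mult_nonneg_nonpos) auto
    also have "0 \<le> n v\<^sub>2 / 2 * (\<delta> * ((1 + \<omega> / 2) / (1 - \<omega> / 2) + (1 + \<omega> / 2) * \<eta>))"
      using n2 \<delta>0 \<omega> \<eta> by (intro mult_nonneg_nonneg add_nonneg_nonneg divide_nonneg_nonneg) auto
    finally show ?thesis .
  next
    case False
    then have z2: "0 < z v\<^sub>2" using z_nonneg[OF v2_mem] by simp
    have z_ge: "z v\<^sub>2 \<le> z v" if v: "v \<in> {v\<^sub>1..v\<^sub>2}" for v
    proof (rule DERIV_nonpos_imp_nonincreasing[of v v\<^sub>2 z])
      fix t assume "v \<le> t" "t \<le> v\<^sub>2"
      then have t: "t \<in> {v\<^sub>1..v\<^sub>2}" using v by auto
      show "\<exists>y. (z has_real_derivative y) (at t) \<and> y \<le> 0"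
        using z_deriv[OF t] r_pos[OF t] W_pos[OF t] by (intro exI conjI) auto
    qed (use v in simp)
    have z_pos: "0 < z v" if "v \<in> {v\<^sub>1..v\<^sub>2}" for v using z_ge[OF that] z2 by simp
    \<comment> \<open>The part of \<open>\<eta>\<close> left after the charge has taken its share
      from the logarithmic growth of \<open>z v\<^sub>1 / z v\<^sub>2\<close>; it is also the weight
      in the final use of Young's inequality.\<close>
    define \<eta>' where "\<eta>' = (1 - \<omega> / 2) * \<eta>"
    have \<eta>'0: "0 < \<eta>'" using \<omega> \<eta> by (simp add: \<eta>'_def)
    \<comment> \<open>The rate of decrease of \<open>ln z\<close> dominates \<open>2 / r2\<close>
      times the kinetic part of \<open>m'\<close>, since \<open>4 * n * z \<le> 1\<close>
      (nonnegative mass) and \<open>r \<le> r2\<close>. The extra term in \<open>1 / r\<close>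
      absorbs the charge part of \<open>m'\<close>, because
      \<open>Q\<^sup>2 \<le> B\<close>.\<close>
    have ln_deriv: "ln (z v\<^sub>1) + 2 / r2 * (m v\<^sub>1 + B / 2 * (1 / r v\<^sub>1))
        \<ge> ln (z v\<^sub>2) + 2 / r2 * (m v\<^sub>2 + B / 2 * (1 / r v\<^sub>2))"
    proof (rule DERIV_nonpos_imp_nonincreasing
        [where f = "\<lambda>v. ln (z v) + 2 / r2 * (m v + B / 2 * (1 / r v))"])
      fix t assume "v\<^sub>1 \<le> t" "t \<le> v\<^sub>2"
      then have t: "t \<in> {v\<^sub>1..v\<^sub>2}" by auto
      note pos = r_pos[OF t] W_pos[OF t] z_pos[OF t] n_pos[OF t]
      let ?p = "(cmod (\<phi>' t))\<^sup>2"
      let ?d = "- (4 * pi * r t / W t * ?p) / z t + 2 / r2 * (m' t - B / 2 * (W t * z t / (r t)\<^sup>2))"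
      have "((\<lambda>v. ln (z v) + 2 / r2 * (m v + B / 2 * (1 / r v))) has_real_derivative ?d) (at t)"
        using pos r2
        by (auto intro!: derivative_eq_intros z_deriv[OF t] m'_deriv[OF t] r_deriv[OF t]
            simp: field_simps power2_eq_square)
      moreover have "?d \<le> 0"
      proof -
        have nz: "4 * n t * z t \<le> 1"
        proof -
          have "0 \<le> m t" using m_mono[of v\<^sub>1 t] m1_nonneg t by simp
          then have "0 \<le> r t * (1 - 4 * n t * z t)" using m_eq[OF t] by simp
          then show ?thesis using pos by (simp add: zero_le_mult_iff)
        qed
        have "m' t - B / 2 * (W t * z t / (r t)\<^sup>2)
            = 8 * pi * (r t)\<^sup>2 * (n t / W t) * ?p + W t * z t / (2 * (r t)\<^sup>2) * ((Q t)\<^sup>2 - B)"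
          using pos by (simp add: m'_def field_simps)
        also have "\<dots> \<le> 8 * pi * (r t)\<^sup>2 * (n t / W t) * ?p"
        proof -
          have "W t * z t / (2 * (r t)\<^sup>2) * ((Q t)\<^sup>2 - B) \<le> 0"
            using Q_le[OF t] pos by (intro mult_nonneg_nonpos) auto
          then show ?thesis by linarith
        qed
        finally have "2 / r2 * (m' t - B / 2 * (W t * z t / (r t)\<^sup>2))
            \<le> 2 / r2 * (8 * pi * (r t)\<^sup>2 * (n t / W t) * ?p)"
          using r2 by (intro mult_left_mono) auto
        also have "\<dots> \<le> 2 / r t * (8 * pi * (r t)\<^sup>2 * (n t / W t) * ?p)"
          using pos r2 r_mono[of t v\<^sub>2] t
          by (intro mult_right_mono divide_left_mono mult_nonneg_nonneg) (auto simp: r2_def)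
        also have "\<dots> = (4 * n t * z t) * (4 * pi * r t / W t * ?p / z t)"
          using pos by (simp add: field_simps power2_eq_square)
        also have "\<dots> \<le> 1 * (4 * pi * r t / W t * ?p / z t)"
          using pos by (intro mult_right_mono[OF nz]) auto
        finally show ?thesis by simp
      qed
      ultimately show "\<exists>y. ((\<lambda>v. ln (z v) + 2 / r2 * (m v + B / 2 * (1 / r v)))
          has_real_derivative y) (at t) \<and> y \<le> 0"
        by blast
    qed (use v12 in simp)
    \<comment> \<open>The charge correction is
      \<open>21 / 52 * \<omega> * \<eta> * \<delta>\<close>; with
      \<open>\<delta> \<le> 1 / 2\<close> it fits into the reserved
      \<open>\<omega> / 2 * \<eta>\<close>.\<close>
    have "\<eta>' \<le> ln (z v\<^sub>1 / z v\<^sub>2)"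
    proof -
      have "2 / r2 * (B / 2 * (1 / r1 - 1 / r2)) = 21 / 52 * \<omega> * \<eta> * \<delta>"
        using r1 r2 by (simp add: B_def \<delta>_def power2_eq_square field_simps flip: r1_def r2_def)
      also have "\<dots> \<le> 21 / 52 * \<omega> * \<eta> * (1 / 2)"
        using \<delta>_le \<omega> \<eta> by (intro mult_left_mono) auto
      also have "\<dots> \<le> \<omega> / 2 * \<eta>" using \<omega> \<eta> by simp
      finally have "2 / r2 * (B / 2 * (1 / r1 - 1 / r2)) \<le> \<omega> / 2 * \<eta>" .
      moreover have "2 / r2 * (m v\<^sub>2 - m v\<^sub>1) = \<eta>" by (simp add: \<eta>_def r2_def)
      moreover have "ln (z v\<^sub>1 / z v\<^sub>2) = ln (z v\<^sub>1) - ln (z v\<^sub>2)"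
        using z_pos[OF v1_mem] z2 by (simp add: ln_div)
      moreover have "2 / r2 * (m v\<^sub>2 - m v\<^sub>1) - 2 / r2 * (B / 2 * (1 / r1 - 1 / r2))
          = 2 / r2 * (m v\<^sub>2 + B / 2 * (1 / r v\<^sub>2)) - 2 / r2 * (m v\<^sub>1 + B / 2 * (1 / r v\<^sub>1))"
        unfolding r1_def r2_def by (simp only: right_diff_distrib distrib_left)
      moreover have "\<eta>' = \<eta> - \<omega> / 2 * \<eta>" by (simp add: \<eta>'_def left_diff_distrib)
      ultimately show ?thesis
        using ln_deriv by linarith
    qed
    then have "1 + \<eta>' \<le> z v\<^sub>1 / z v\<^sub>2"
      using z_pos[OF v1_mem] z2 exp_ge_add_one_self[of \<eta>'] ln_ge_iff[of "z v\<^sub>1 / z v\<^sub>2" \<eta>']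
      by (meson divide_pos_pos order_trans)
    then have z12: "z v\<^sub>2 * (1 + \<eta>') \<le> z v\<^sub>1"
      using z2 by (simp add: field_simps)
    \<comment> \<open>Young weight separating the kinetic and charge parts of the derivative of
      \<open>X\<close>. It costs \<open>\<omega> / 4\<close> on the kinetic part; the charge part is
      fitted into another \<open>\<omega> / 4\<close>, hence the factor
      \<open>1 + \<omega> / 2\<close> below.\<close>
    define c where "c = \<omega> / 4"
    have c: "0 < c" using \<omega> by (simp add: c_def)
    define K where "K = e\<^sup>2 / (8 * \<kappa>) * B * \<Phi>"
    have K: "0 \<le> K" using \<kappa> B0 \<Phi>0 by (simp add: K_def)
    define T where "T = n v\<^sub>2 / z v\<^sub>2 * (\<delta> / r2) * ((1 + c) / (8 * pi) * \<Delta> + (1 + 1 / c) * K * D)"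
    \<comment> \<open>Cauchy--Schwarz with \<open>W * z / r\<^sup>2\<close> as second density: it is
      the derivative of \<open>- 1 / r\<close>, so it integrates to \<open>\<delta> / r2\<close>.
      The \<open>z t\<close> in it is created by inserting
      \<open>z t / z v\<^sub>2 \<ge> 1\<close>.\<close>
    have XT: "(cmod (X v\<^sub>2 - X v\<^sub>1))\<^sup>2 \<le> T"
    proof -
      let ?F = "\<lambda>t. n v\<^sub>2 / z v\<^sub>2 * ((1 + c) / (8 * pi) * m t + (1 + 1 / c) * K * t)"
      let ?F' = "\<lambda>t. n v\<^sub>2 / z v\<^sub>2 * ((1 + c) / (8 * pi) * m' t + (1 + 1 / c) * K)"
      have "(cmod (X v\<^sub>2 - X v\<^sub>1))\<^sup>2 \<le> (?F v\<^sub>2 - ?F v\<^sub>1) * (- 1 / r v\<^sub>2 - - 1 / r v\<^sub>1)"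
      proof (rule norm_increment_square_le[OF v12 X_deriv])
        fix t assume t: "t \<in> {v\<^sub>1..v\<^sub>2}"
        note pos = r_pos[OF t] W_pos[OF t] z_pos[OF t] n_pos[OF t]
        let ?G' = "W t * z t / (r t)\<^sup>2"
        show "(?F has_real_derivative ?F' t) (at t)"
          using z2 by (auto intro!: derivative_eq_intros m'_deriv[OF t] simp: mult_ac)
        show "((\<lambda>t. - 1 / r t) has_real_derivative ?G') (at t)"
          using pos by (auto intro!: derivative_eq_intros r_deriv[OF t] simp: power2_eq_square)
        show "0 \<le> ?F' t"
          using n2 z2 c K m'_nonneg[OF t] by simp
        show "0 \<le> ?G'" using pos by simp
        have n_le: "n t \<le> n v\<^sub>2" using n_mono[of t v\<^sub>2] t by simp
        have m_le: "m t \<le> m v\<^sub>2" using m_mono[of t v\<^sub>2] t by simp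
        have z_ratio: "a \<le> a * (z t / z v\<^sub>2)" if "0 \<le> a" for a
          using mult_left_mono[OF _ that, of 1 "z t / z v\<^sub>2"] z_ge[OF t] z2 by simp
        have \<phi>_le: "(cmod (\<phi> t))\<^sup>2 \<le> \<Phi>"
        proof -
          have "(cmod (\<phi> t))\<^sup>2 \<le> 2 * (cmod (\<phi> v\<^sub>1))\<^sup>2 + (m t - m v\<^sub>1) * D / (2 * pi * \<kappa> * r1\<^sup>2)"
            using \<phi>_square_le[OF t] by (simp add: D_def \<kappa>_def r1_def)
          also have "\<dots> \<le> \<Phi>"
            unfolding \<Phi>_def \<Delta>_def using m_le D \<kappa>
            by (intro add_left_mono divide_right_mono mult_right_mono) auto
          finally show ?thesis .
        qed
        have W_le: "W t \<le> 2 / \<kappa> * n v\<^sub>2"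
        proof -
          have "\<kappa> / 2 * W t \<le> n v\<^sub>2" using n_ge[OF t] n_le by (simp add: \<kappa>_def)
          then show ?thesis using \<kappa> by (simp add: field_simps)
        qed
        have first: "(n t)\<^sup>2 * (cmod (\<phi>' t))\<^sup>2 \<le> n v\<^sub>2 / z v\<^sub>2 * (m' t / (8 * pi)) * ?G'"
        proof -
          have "(n t)\<^sup>2 * (cmod (\<phi>' t))\<^sup>2
              = 8 * pi * (r t)\<^sup>2 * (n t / W t) * (cmod (\<phi>' t))\<^sup>2 * (W t / (8 * pi * (r t)\<^sup>2)) * n t"
            using pos by (simp add: power2_eq_square)
          also have "\<dots> \<le> m' t * (W t / (8 * pi * (r t)\<^sup>2)) * n v\<^sub>2"
            using kinetic_le_m'[OF t] n_le pos m'_nonneg[OF t] by (intro mult_mono) auto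
          also have "\<dots> \<le> m' t * (W t / (8 * pi * (r t)\<^sup>2)) * n v\<^sub>2 * (z t / z v\<^sub>2)"
            using pos n2 m'_nonneg[OF t] by (intro z_ratio mult_nonneg_nonneg) auto
          also have "\<dots> = n v\<^sub>2 / z v\<^sub>2 * (m' t / (8 * pi)) * ?G'"
            by (simp add: field_simps)
          finally show ?thesis .
        qed
        have second: "(e * W t * Q t / (4 * r t))\<^sup>2 * (cmod (\<phi> t))\<^sup>2 \<le> n v\<^sub>2 / z v\<^sub>2 * K * ?G'"
        proof -
          have "(e * W t * Q t / (4 * r t))\<^sup>2 * (cmod (\<phi> t))\<^sup>2
              = e\<^sup>2 / (16 * (r t)\<^sup>2) * W t * W t * (Q t)\<^sup>2 * (cmod (\<phi> t))\<^sup>2"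
            by (simp add: power_mult_distrib power_divide power2_eq_square)
          also have "\<dots> \<le> e\<^sup>2 / (16 * (r t)\<^sup>2) * W t * (2 / \<kappa> * n v\<^sub>2) * B * \<Phi>"
            using W_le Q_le[OF t] \<phi>_le pos \<kappa> n2 B0 by (intro mult_mono mult_nonneg_nonneg) auto
          also have "\<dots> \<le> e\<^sup>2 / (16 * (r t)\<^sup>2) * W t * (2 / \<kappa> * n v\<^sub>2) * B * \<Phi> * (z t / z v\<^sub>2)"
            using pos n2 \<kappa> B0 \<Phi>0 by (intro z_ratio mult_nonneg_nonneg) auto
          also have "\<dots> = n v\<^sub>2 / z v\<^sub>2 * K * ?G'"
            by (simp add: K_def field_simps)
          finally show ?thesis .
        qed
        have "(cmod (of_real (n t) * \<phi>' t - \<i> * of_real (e * W t * Q t / (4 * r t)) * \<phi> t))\<^sup>2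
            \<le> (1 + c) * ((n t)\<^sup>2 * (cmod (\<phi>' t))\<^sup>2)
              + (1 + 1 / c) * ((e * W t * Q t / (4 * r t))\<^sup>2 * (cmod (\<phi> t))\<^sup>2)"
          using norm_add_square_le[OF c, of "of_real (n t) * \<phi>' t"
              "- (\<i> * of_real (e * W t * Q t / (4 * r t)) * \<phi> t)"]
          by (simp add: norm_mult norm_divide power_mult_distrib power_divide del: of_real_mult of_real_divide)
        also have "\<dots> \<le> (1 + c) * (n v\<^sub>2 / z v\<^sub>2 * (m' t / (8 * pi)) * ?G')
              + (1 + 1 / c) * (n v\<^sub>2 / z v\<^sub>2 * K * ?G')"
          using first second c by (intro add_mono mult_left_mono) auto
        also have "\<dots> = ?F' t * ?G'"
          using c z2 by (simp add: distrib_left distrib_right add_divide_distrib mult_ac)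
        finally show "(cmod (of_real (n t) * \<phi>' t - \<i> * of_real (e * W t * Q t / (4 * r t)) * \<phi> t))\<^sup>2
            \<le> ?F' t * ?G'" .
      qed
      also have "\<dots> = T"
      proof -
        have "- 1 / r v\<^sub>2 - - 1 / r v\<^sub>1 = \<delta> / r2"
          using r1 r2 by (simp add: \<delta>_def field_simps flip: r1_def r2_def)
        moreover have "?F v\<^sub>2 - ?F v\<^sub>1
            = n v\<^sub>2 / z v\<^sub>2 * ((1 + c) / (8 * pi) * \<Delta> + (1 + 1 / c) * K * D)"
          by (simp add: \<Delta>_def D_def algebra_simps diff_divide_distrib add_divide_distrib)
        ultimately show ?thesis by (simp add: T_def)
      qed
      finally show ?thesis .
    qed
    have T_le: "8 * pi * T \<le> n v\<^sub>2 / z v\<^sub>2 * \<delta> * (\<eta> / 2 * (1 + \<omega> / 2))"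
    proof -
      have ratio: "r2\<^sup>2 / r1\<^sup>2 * \<eta> \<le> 9 / 4 * 1"
      proof (rule mult_mono)
        have "r2\<^sup>2 \<le> (3 / 2 * r1)\<^sup>2" using r2_le r2 by (intro power_mono) auto
        then show "r2\<^sup>2 / r1\<^sup>2 \<le> 9 / 4" using r1 by (simp add: field_simps power2_eq_square)
      qed (use \<eta>1 \<eta> in auto)
      \<comment> \<open>Expanding \<open>\<Phi>\<close> produces the coefficients of
        \<open>small2\<close>; its 45 is \<open>20 * 9 / 4\<close>, the \<open>9 / 4\<close> coming
        from \<open>r2 \<le> 3 / 2 * r1\<close> and \<open>\<eta> \<le> 1\<close>.\<close>
      have "e\<^sup>2 * pi * \<Phi> * D / \<kappa> * r2 = (160 * pi * e\<^sup>2 * r2 * (D / \<kappa>) * (cmod (\<phi> v\<^sub>1))\<^sup>2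
          + 20 * e\<^sup>2 * D\<^sup>2 / \<kappa>\<^sup>2 * (r2\<^sup>2 / r1\<^sup>2 * \<eta>)) / 80"
        using \<kappa> r1 by (simp add: \<Phi>_def \<Delta>_eq field_simps power2_eq_square)
      also have "\<dots> \<le> (160 * pi * e\<^sup>2 * r2 * (D / \<kappa>) * (cmod (\<phi> v\<^sub>1))\<^sup>2
          + 20 * e\<^sup>2 * D\<^sup>2 / \<kappa>\<^sup>2 * (9 / 4 * 1)) / 80"
        using ratio by (intro divide_right_mono add_left_mono mult_left_mono) auto
      also have "\<dots> \<le> \<omega> / 20"
        using small2 by (simp add: D_def \<kappa>_def r2_def)
      finally have small: "e\<^sup>2 * pi * \<Phi> * D / \<kappa> * r2 \<le> \<omega> / 20" .
      have "8 * pi * K * D = 21 / 52 * \<omega> * \<eta> * r2 * (e\<^sup>2 * pi * \<Phi> * D / \<kappa> * r2)"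
        by (simp add: K_def B_def power2_eq_square)
      also have "\<dots> \<le> 21 / 52 * \<omega> * \<eta> * r2 * (\<omega> / 20)"
        using small \<omega> \<eta> r2 by (intro mult_left_mono) auto
      finally have "(1 + 1 / c) * (8 * pi * K * D) \<le> (1 + 1 / c) * (21 / 52 * \<omega> * \<eta> * r2 * (\<omega> / 20))"
        using c by (intro mult_left_mono) auto
      also have "\<dots> = r2 * (\<eta> / 2) * (21 / 520 * (\<omega> + 4) * \<omega>)"
        using \<omega> by (simp add: c_def field_simps)
      also have "\<dots> \<le> r2 * (\<eta> / 2) * (1 / 4 * \<omega>)"
        using \<omega> \<eta> r2 by (intro mult_left_mono mult_right_mono) auto
      finally have K_le: "(1 + 1 / c) * (8 * pi * K * D) \<le> r2 * (\<eta> / 2) * (1 / 4 * \<omega>)" .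
      have "8 * pi * T = n v\<^sub>2 / z v\<^sub>2 * (\<delta> / r2) * ((1 + c) * \<Delta> + (1 + 1 / c) * (8 * pi * K * D))"
      proof -
        have "8 * pi * ((1 + c) / (8 * pi) * \<Delta> + (1 + 1 / c) * K * D)
            = (1 + c) * \<Delta> + (1 + 1 / c) * (8 * pi * K * D)"
          by (simp add: distrib_left)
        then show ?thesis
          by (simp add: T_def mult.left_commute[of "8 * pi"] mult.assoc)
      qed
      also have "\<dots> \<le> n v\<^sub>2 / z v\<^sub>2 * (\<delta> / r2) * (r2 * (\<eta> / 2 * (1 + \<omega> / 2)))"
      proof (rule mult_left_mono)
        have "(1 + c) * \<Delta> = r2 * (\<eta> / 2) + r2 * (\<eta> / 2) * (1 / 4 * \<omega>)"
          by (simp add: \<Delta>_eq c_def distrib_right)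
        moreover have "r2 * (\<eta> / 2 * (1 + \<omega> / 2)) = r2 * (\<eta> / 2) + 2 * (r2 * (\<eta> / 2) * (1 / 4 * \<omega>))"
          by (simp add: distrib_left)
        ultimately show "(1 + c) * \<Delta> + (1 + 1 / c) * (8 * pi * K * D) \<le> r2 * (\<eta> / 2 * (1 + \<omega> / 2))"
          using K_le by linarith
      qed (use n2 z2 \<delta>0 r2 in auto)
      also have "\<dots> = n v\<^sub>2 / z v\<^sub>2 * \<delta> * (\<eta> / 2 * (1 + \<omega> / 2))"
        using r2 by simp
      finally show ?thesis .
    qed
    \<comment> \<open>With weight \<open>\<eta>'\<close> the term in \<open>X v\<^sub>1\<close> is
      at most the flux through \<open>v\<^sub>1\<close>, by \<open>z12\<close>, and cancels; only
      the increment bound \<open>T\<close> remains.\<close>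
    have "z v\<^sub>2 * (cmod (X v\<^sub>2))\<^sup>2 \<le> z v\<^sub>2 * ((1 + \<eta>') * (cmod (X v\<^sub>1))\<^sup>2 + (1 + 1 / \<eta>') * T)"
    proof (rule mult_left_mono)
      have "(cmod (X v\<^sub>2))\<^sup>2 \<le> (1 + \<eta>') * (cmod (X v\<^sub>1))\<^sup>2 + (1 + 1 / \<eta>') * (cmod (X v\<^sub>2 - X v\<^sub>1))\<^sup>2"
        using norm_add_square_le[OF \<eta>'0, of "X v\<^sub>1" "X v\<^sub>2 - X v\<^sub>1"] by simp
      also have "\<dots> \<le> (1 + \<eta>') * (cmod (X v\<^sub>1))\<^sup>2 + (1 + 1 / \<eta>') * T"
        using XT \<eta>'0 by (intro add_left_mono mult_left_mono) auto
      finally show "(cmod (X v\<^sub>2))\<^sup>2 \<le> (1 + \<eta>') * (cmod (X v\<^sub>1))\<^sup>2 + (1 + 1 / \<eta>') * T" .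
    qed (use z2 in simp)
    moreover have "z v\<^sub>2 * (1 + \<eta>') * (cmod (X v\<^sub>1))\<^sup>2 \<le> z v\<^sub>1 * (cmod (X v\<^sub>1))\<^sup>2"
      using z12 by (rule mult_right_mono) simp
    ultimately have "z v\<^sub>2 * (cmod (X v\<^sub>2))\<^sup>2 - z v\<^sub>1 * (cmod (X v\<^sub>1))\<^sup>2 \<le> z v\<^sub>2 * (1 + 1 / \<eta>') * T"
      by (simp add: algebra_simps)
    then have "8 * pi * (z v\<^sub>2 * (cmod (X v\<^sub>2))\<^sup>2 - z v\<^sub>1 * (cmod (X v\<^sub>1))\<^sup>2)
        \<le> 8 * pi * (z v\<^sub>2 * (1 + 1 / \<eta>') * T)"
      by (rule mult_left_mono) simp
    also have "\<dots> = z v\<^sub>2 * (1 + 1 / \<eta>') * (8 * pi * T)"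
      by simp
    also have "\<dots> \<le> z v\<^sub>2 * (1 + 1 / \<eta>') * (n v\<^sub>2 / z v\<^sub>2 * \<delta> * (\<eta> / 2 * (1 + \<omega> / 2)))"
      using T_le z2 \<eta>'0 by (intro mult_left_mono) auto
    also have "\<dots> = n v\<^sub>2 / 2 * (\<delta> * ((1 + \<omega> / 2) * (\<eta> * (1 + 1 / \<eta>'))))"
      using z2 by simp
    also have "\<eta> * (1 + 1 / \<eta>') = \<eta> + 1 / (1 - \<omega> / 2)"
      using \<eta> \<omega> by (simp add: \<eta>'_def field_simps)
    also have "(1 + \<omega> / 2) * (\<eta> + 1 / (1 - \<omega> / 2)) = (1 + \<omega> / 2) / (1 - \<omega> / 2) + (1 + \<omega> / 2) * \<eta>"
      by (simp add: algebra_simps)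
    finally show ?thesis .
  qed
  have "n v\<^sub>2 * (Q v\<^sub>2)\<^sup>2 / (2 * (r v\<^sub>2)\<^sup>2) \<le> n v\<^sub>2 * B / (2 * r2\<^sup>2)"
    unfolding r2_def using Q_le[OF v2_mem] n2 by (intro divide_right_mono mult_left_mono) auto
  also have "\<dots> = n v\<^sub>2 / 2 * (21 / 52 * \<omega> * \<eta>)"
    using r2 by (simp add: B_def)
  also have "\<dots> \<le> n v\<^sub>2 / 2 * (\<omega> / 2 * \<eta>)"
    using n2 \<omega> \<eta> by (intro mult_left_mono) auto
  finally show ?thesis using flux by (simp add: distrib_left)
qed

end

section \<open>The differential inequality for the mass ratio\<close>

text \<open>Continuous induction: the closed set where \<open>f \<le> 0\<close> would have a first
  point, which \<open>step\<close> excludes. At \<open>w = a\<close> the premise of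
  \<open>step\<close> is vacuous, so it contains the base case.\<close>

lemma positive_continuation:
  fixes f :: "real \<Rightarrow> real"
  assumes cont: "continuous_on {a..b} f"
    and step: "\<And>w. w \<in> {a..b} \<Longrightarrow> (\<And>u. a \<le> u \<Longrightarrow> u < w \<Longrightarrow> 0 < f u) \<Longrightarrow> 0 < f w"
    and w: "w \<in> {a..b}"
  shows "0 < f w"
proof (rule ccontr)
  assume "\<not> 0 < f w"
  define B where "B = {u \<in> {a..b}. f u \<le> 0}"
  have "closed B"
    unfolding B_def using cont by (intro continuous_on_closed_Collect_le continuous_on_const) auto
  moreover have ne: "B \<noteq> {}" and bdd: "bdd_below B"
    using w \<open>\<not> 0 < f w\<close> by (auto simp: B_def bdd_below_def)
  ultimately have "Inf B \<in> B" by (simp add: closed_contains_Inf)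
  moreover have "0 < f u" if "a \<le> u" "u < Inf B" for u
  proof (rule ccontr)
    assume "\<not> 0 < f u"
    then have "u \<in> B" using that \<open>Inf B \<in> B\<close> by (auto simp: B_def)
    then show False using cInf_lower[OF _ bdd] that by force
  qed
  ultimately show False using step[of "Inf B"] by (auto simp: B_def)
qed

text \<open>
  The integrating factor of \<open>x \<eta>' + \<eta> \<le> a / (x - a) * (K + (1 + \<omega> / 2) \<eta>) + \<omega> / 2 * \<eta>\<close>, and a primitive
  of the source term it produces.
\<close>

definition weight :: "real \<Rightarrow> real \<Rightarrow> real \<Rightarrow> real" where
  "weight \<omega> a x = x\<^sup>2 * (x - a) powr - (1 + \<omega> / 2)"

definition source :: "real \<Rightarrow> real \<Rightarrow> real \<Rightarrow> real" where
  "source \<omega> a x = - ((1 + \<omega> / 2) / (1 - \<omega> / 2) *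
    (2 / \<omega> * a * (x - a) powr - (\<omega> / 2) + a\<^sup>2 / (1 + \<omega> / 2) * (x - a) powr - (1 + \<omega> / 2)))"

lemma source_mono:
  assumes \<omega>: "0 < \<omega>" "\<omega> < 2" and a: "0 < a" and xy: "a < x" "x \<le> y"
  shows "source \<omega> a x \<le> source \<omega> a y"
proof -
  have "(y - a) powr - k \<le> (x - a) powr - k" if "0 < k" for k
    using that xy by (intro powr_mono2') auto
  then show ?thesis
    unfolding source_def using \<omega> a
    by (intro le_imp_neg_le mult_left_mono add_mono) (auto simp del: minus_add_distrib)
qed

text \<open>The derivative has the sign of \<open>(1 - \<omega> / 2) * t - 2 * a\<close>; since
  \<open>1 - \<omega> / 2 > 2 / 3\<close> and \<open>t \<ge> 3 * a\<close>, it is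
  nonnegative.\<close>

lemma weight_mono:
  assumes \<omega>: "0 < \<omega>" "\<omega> < 2 / 3" and a: "0 < a" and xy: "3 * a \<le> x" "x \<le> y"
  shows "weight \<omega> a x \<le> weight \<omega> a y"
proof (rule DERIV_nonneg_imp_nondecreasing[OF xy(2)])
  fix t assume "x \<le> t" "t \<le> y"
  then have t: "3 * a \<le> t" using xy by simp
  let ?p = "1 + \<omega> / 2"
  have ta: "0 < t - a" using t a by simp
  define q where "q = (t - a) powr (- ?p - 1)"
  have "((\<lambda>x. (x - a) powr - ?p) has_real_derivative - ?p * q * 1) (at t)"
    unfolding q_def using ta
    by (intro DERIV_chain2[where f = "\<lambda>z. z powr - ?p" and g = "\<lambda>x. x - a"])
       (auto intro!: derivative_eq_intros has_real_derivative_powr simp del: minus_add_distrib)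
  from DERIV_mult[OF DERIV_power[OF DERIV_ident, where n = 2] this]
  have "(weight \<omega> a has_real_derivative 2 * t * (t - a) powr - ?p + t\<^sup>2 * (- ?p * q)) (at t)"
    unfolding weight_def[abs_def] by (simp add: mult_ac add.commute del: minus_add_distrib)
  moreover have "(t - a) powr - ?p = (t - a) * q"
    using ta powr_mult_base[of "t - a" "- ?p - 1"] by (simp add: q_def)
  then have "2 * t * (t - a) powr - ?p + t\<^sup>2 * (- ?p * q) = t * q * ((1 - \<omega> / 2) * t - 2 * a)"
    by (simp only:) (simp add: algebra_simps power2_eq_square)
  moreover have "0 \<le> (1 - \<omega> / 2) * t - 2 * a"
  proof -
    have "2 / 3 * (3 * a) \<le> (1 - \<omega> / 2) * t" using \<omega> t a by (intro mult_mono) auto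
    then show ?thesis by simp
  qed
  ultimately show "\<exists>y. (weight \<omega> a has_real_derivative y) (at t) \<and> 0 \<le> y"
    using t a by (intro exI[of _ "t * q * ((1 - \<omega> / 2) * t - 2 * a)"] conjI mult_nonneg_nonneg)
      (auto simp: q_def simp del: minus_add_distrib)
qed

section \<open>Endpoint values of the integrating factor and the source primitive\<close>

lemma powr_inverse: "0 < s \<Longrightarrow> (1 / s) powr - k = s powr k" for s k :: real
  by (simp add: powr_divide powr_minus_divide)

lemma two_powr:
  fixes \<omega> :: real
  shows "2 powr (1 + \<omega> / 2) = 2 / (2::real) powr - (\<omega> / 2)"
    and "2 powr (1 - \<omega> / 2) = 2 * (2::real) powr - (\<omega> / 2)"
  by (simp_all add: powr_add powr_diff powr_minus_divide)

context
  fixes \<omega> \<delta>\<^sub>0 a :: real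
  assumes \<omega>: "0 < \<omega>" "\<omega> < 2 / 3" and \<delta>\<^sub>0: "0 < \<delta>\<^sub>0" and a_eq: "a = \<delta>\<^sub>0 / (1 + \<delta>\<^sub>0)"
begin

lemma weight_1: "weight \<omega> a 1 = (1 + \<delta>\<^sub>0) * (1 + \<delta>\<^sub>0) powr (\<omega> / 2)"
proof -
  have "1 - a = 1 / (1 + \<delta>\<^sub>0)" using \<delta>\<^sub>0 by (simp add: a_eq field_simps)
  then have "weight \<omega> a 1 = (1 + \<delta>\<^sub>0) powr (1 + \<omega> / 2)"
    using \<delta>\<^sub>0 powr_inverse[of "1 + \<delta>\<^sub>0" "1 + \<omega> / 2"] by (simp add: weight_def del: minus_add_distrib)
  then show ?thesis using \<delta>\<^sub>0 by (simp add: powr_add)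
qed

text \<open>At the final value \<open>x = 3 * a\<close> the base \<open>x - a\<close> is
  \<open>2 * a\<close>, the origin of the powers of 2 in \<open>g\<close> and in the
  threshold.\<close>

lemma powr_2a:
  "(3 * a - a) powr - (\<omega> / 2)
     = 2 powr - (\<omega> / 2) * \<delta>\<^sub>0 powr - (\<omega> / 2) * (1 + \<delta>\<^sub>0) powr (\<omega> / 2)"
  "(3 * a - a) powr - (1 + \<omega> / 2)
     = 2 powr - (\<omega> / 2) * \<delta>\<^sub>0 powr - (\<omega> / 2) * (1 + \<delta>\<^sub>0) powr (\<omega> / 2) * (1 + \<delta>\<^sub>0) / (2 * \<delta>\<^sub>0)"
proof -
  have *: "3 * a - a = 2 * \<delta>\<^sub>0 / (1 + \<delta>\<^sub>0)" by (simp add: a_eq)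
  show A: "(3 * a - a) powr - (\<omega> / 2)
     = 2 powr - (\<omega> / 2) * \<delta>\<^sub>0 powr - (\<omega> / 2) * (1 + \<delta>\<^sub>0) powr (\<omega> / 2)"
    unfolding * using \<delta>\<^sub>0 by (simp add: powr_divide powr_mult powr_minus_divide)
  have "(3 * a - a) powr - (1 + \<omega> / 2) = (3 * a - a) powr - (\<omega> / 2) / (3 * a - a)"
  proof -
    have "- (1 + \<omega> / 2) = - (\<omega> / 2) - 1" by simp
    then show ?thesis
      using \<delta>\<^sub>0 powr_diff[of "3 * a - a" "- (\<omega> / 2)" 1] by (simp only:) (simp add: a_eq)
  qed
  then show "(3 * a - a) powr - (1 + \<omega> / 2)
     = 2 powr - (\<omega> / 2) * \<delta>\<^sub>0 powr - (\<omega> / 2) * (1 + \<delta>\<^sub>0) powr (\<omega> / 2) * (1 + \<delta>\<^sub>0) / (2 * \<delta>\<^sub>0)"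
    unfolding A unfolding * by simp
qed

lemma delta_powr: "\<delta>\<^sub>0 powr (1 - \<omega> / 2) = \<delta>\<^sub>0 * \<delta>\<^sub>0 powr - (\<omega> / 2)"
  using \<delta>\<^sub>0 by (simp add: powr_diff powr_minus_divide)

text \<open>Identifies the second threshold for \<open>\<eta>\<^sub>0\<close>, apart from its
  summand \<open>g \<omega> \<delta>\<^sub>0\<close>, as the quotient of the final and initial
  weights: exactly what forces a final ratio above 1.\<close>

lemma weight_3a:
  "weight \<omega> a (3 * a) = weight \<omega> a 1 * (9 / (2 powr (1 + \<omega> / 2) * (1 + \<delta>\<^sub>0)\<^sup>2) * \<delta>\<^sub>0 powr (1 - \<omega> / 2))"
proof -
  have "weight \<omega> a (3 * a) = (3 * a)\<^sup>2 * (2 powr - (\<omega> / 2) * \<delta>\<^sub>0 powr - (\<omega> / 2)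
      * (1 + \<delta>\<^sub>0) powr (\<omega> / 2) * (1 + \<delta>\<^sub>0) / (2 * \<delta>\<^sub>0))"
    unfolding weight_def powr_2a ..
  also have "\<dots> = weight \<omega> a 1 * (9 / (2 powr (1 + \<omega> / 2) * (1 + \<delta>\<^sub>0)\<^sup>2) * \<delta>\<^sub>0 powr (1 - \<omega> / 2))"
  proof -
    define s where "s = 1 + \<delta>\<^sub>0"
    have "0 < s" using \<delta>\<^sub>0 by (simp add: s_def)
    then show ?thesis
      using \<delta>\<^sub>0 unfolding weight_1 two_powr delta_powr unfolding a_eq s_def[symmetric]
      by (simp add: field_simps power2_eq_square)
  qed
  finally show ?thesis .
qed

text \<open>This explains \<open>g\<close>: it is the source integrated from
  \<open>x = 3 * a\<close> to \<open>x = 1\<close>, normalized by the initial weight.\<close>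

lemma source_diff: "source \<omega> a 1 - source \<omega> a (3 * a) = weight \<omega> a 1 * g \<omega> \<delta>\<^sub>0"
proof -
  \<comment> \<open>Each real power becomes a letter, so that a purely rational identity
    remains.\<close>
  define s S q t p where "s = 1 + \<delta>\<^sub>0" and "S = s powr (\<omega> / 2)" and "q = \<delta>\<^sub>0 powr - (\<omega> / 2)"
    and "t = (2::real) powr - (\<omega> / 2)" and "p = 1 + \<omega> / 2"
  have pos: "0 < s" "0 < p" "0 < t" using \<delta>\<^sub>0 \<omega> by (simp_all add: s_def p_def t_def)
  have "1 - a = 1 / s" using \<delta>\<^sub>0 by (simp add: a_eq field_simps s_def)
  then have y1: "(1 - a) powr - (\<omega> / 2) = S" "(1 - a) powr - p = s * S"
    using pos powr_inverse[of s "\<omega> / 2"] powr_inverse[of s p] powr_add[of s 1 "\<omega> / 2"]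
    by (simp_all add: S_def p_def del: minus_add_distrib)
  have y3: "(3 * a - a) powr - (\<omega> / 2) = t * q * S" "(3 * a - a) powr - p = t * q * S * s / (2 * \<delta>\<^sub>0)"
    using powr_2a by (simp_all add: s_def S_def q_def t_def p_def)
  have g: "g \<omega> \<delta>\<^sub>0 = p / (1 - \<omega> / 2) * (1 / s\<^sup>2) * ((2 * t / \<omega> + 1 / (2 / t * p)) * (\<delta>\<^sub>0 * q)
      - 2 / \<omega> * \<delta>\<^sub>0 - 1 / p * \<delta>\<^sub>0\<^sup>2)"
    unfolding g_def two_powr delta_powr s_def q_def t_def p_def ..
  have a: "a = \<delta>\<^sub>0 / s" by (simp add: a_eq s_def)
  define K where "K = p / (1 - \<omega> / 2)"
  have "source \<omega> a 1 - source \<omega> a (3 * a) = K * ((2 / \<omega> * a * (t * q * S) + a\<^sup>2 / p * (t * q * S * s / (2 * \<delta>\<^sub>0)))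
      - (2 / \<omega> * a * S + a\<^sup>2 / p * (s * S)))"
    unfolding source_def y1 y3 p_def[symmetric] K_def[symmetric] by (simp add: algebra_simps)
  also have "\<dots> = (s * S) * (K * (1 / s\<^sup>2) * ((2 * t / \<omega> + 1 / (2 / t * p)) * (\<delta>\<^sub>0 * q)
      - 2 / \<omega> * \<delta>\<^sub>0 - 1 / p * \<delta>\<^sub>0\<^sup>2))"
    using pos \<omega> \<delta>\<^sub>0 unfolding a by (simp add: field_simps power2_eq_square)
  also have "\<dots> = weight \<omega> a 1 * g \<omega> \<delta>\<^sub>0"
    unfolding g K_def weight_1 S_def s_def ..
  finally show ?thesis .
qed

text \<open>Integrates \<open>ineq\<close> with the weight. The inequality needs
  \<open>13 * \<epsilon> \<le> \<omega> * \<eta>\<close>, which is recovered by continuous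
  induction. Derivatives are assumed only before \<open>u\<^sub>s\<close>: if
  \<open>u\<^sub>s = 0\<close>, the slice there meets the center at
  \<open>v\<^sub>1\<close>.\<close>

lemma ratio_exceeds_one:
  fixes R R' M M' :: "real \<Rightarrow> real" and \<epsilon> u\<^sub>0 u\<^sub>s :: real
  defines "x \<equiv> \<lambda>u. R u / R u\<^sub>0" and "\<eta> \<equiv> \<lambda>u. 2 * M u / R u"
  assumes u: "u\<^sub>0 \<le> u\<^sub>s" and \<epsilon>: "0 \<le> \<epsilon>" and R0: "0 < R u\<^sub>0"
    and cont: "continuous_on {u\<^sub>0..u\<^sub>s} R" "continuous_on {u\<^sub>0..u\<^sub>s} M"
    and R_deriv: "\<And>u. u\<^sub>0 \<le> u \<Longrightarrow> u < u\<^sub>s \<Longrightarrow> (R has_real_derivative R' u) (at u)"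
    and M_deriv: "\<And>u. u\<^sub>0 \<le> u \<Longrightarrow> u < u\<^sub>s \<Longrightarrow> (M has_real_derivative M' u) (at u)"
    and R_le: "\<And>u. u \<in> {u\<^sub>0..u\<^sub>s} \<Longrightarrow> R u \<le> R u\<^sub>0" and R_ge: "\<And>u. u \<in> {u\<^sub>0..u\<^sub>s} \<Longrightarrow> R u\<^sub>s \<le> R u"
    and R_end: "R u\<^sub>s = 3 * a * R u\<^sub>0"
    and ineq: "\<And>u. u\<^sub>0 \<le> u \<Longrightarrow> u < u\<^sub>s \<Longrightarrow> 13 * \<epsilon> \<le> \<omega> * \<eta> u \<Longrightarrow> 0 < \<eta> u \<Longrightarrow>
      - M' u \<le> - R' u / 2 * (a / (x u - a) * ((1 + \<omega> / 2) / (1 - \<omega> / 2) + (1 + \<omega> / 2) * \<eta> u) + \<omega> / 2 * \<eta> u)"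
    and large: "max (13 * \<epsilon> / \<omega> + g \<omega> \<delta>\<^sub>0)
      (9 / (2 powr (1 + \<omega> / 2) * (1 + \<delta>\<^sub>0)\<^sup>2) * \<delta>\<^sub>0 powr (1 - \<omega> / 2) + g \<omega> \<delta>\<^sub>0) < \<eta> u\<^sub>0"
  shows "1 < \<eta> u\<^sub>s"
proof -
  define p K where "p = 1 + \<omega> / 2" and "K = (1 + \<omega> / 2) / (1 - \<omega> / 2)"
  have a: "0 < a" using \<delta>\<^sub>0 by (simp add: a_eq)
  have x_range: "3 * a \<le> x u" "x u \<le> 1" if "u \<in> {u\<^sub>0..u\<^sub>s}" for u
    using R_le[OF that] R_ge[OF that] R_end R0 by (simp_all add: x_def field_simps)
  have xa: "0 < x u - a" "0 < x u" if "u \<in> {u\<^sub>0..u\<^sub>s}" for u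
    using x_range[OF that] a by simp_all
  have R_pos: "0 < R u" if "u \<in> {u\<^sub>0..u\<^sub>s}" for u
    using xa(2)[OF that] R0 by (simp add: x_def zero_less_divide_iff)
  have weight_pos: "0 < weight \<omega> a y" if "a < y" for y
    using that a by (simp add: weight_def)
  have M_eq: "2 / R u\<^sub>0 * M u = x u * \<eta> u" if "u \<in> {u\<^sub>0..u\<^sub>s}" for u
    using R_pos[OF that] by (simp add: x_def \<eta>_def)
  \<comment> \<open>Weighted ratio minus source, written with \<open>M\<close> instead of
    \<open>\<eta>\<close> to avoid differentiating a quotient.\<close>
  define F where "F u = 2 / R u\<^sub>0 * M u * x u * (x u - a) powr - p - source \<omega> a (x u)" for u
  have F_eq: "F u = weight \<omega> a (x u) * \<eta> u - source \<omega> a (x u)" if "u \<in> {u\<^sub>0..u\<^sub>s}" for u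
    using M_eq[OF that] by (simp add: F_def weight_def p_def power2_eq_square)
  have cont_x: "continuous_on {u\<^sub>0..u\<^sub>s} x"
    unfolding x_def using R0 by (intro continuous_intros cont) simp
  have cont_\<eta>: "continuous_on {u\<^sub>0..u\<^sub>s} \<eta>"
    unfolding \<eta>_def using R_pos by (intro continuous_intros cont) force
  have cont_F: "continuous_on {u\<^sub>0..u\<^sub>s} F"
    unfolding F_def source_def using xa by (intro continuous_intros cont cont_x) force+
  have F_deriv: "\<exists>y. (F has_real_derivative y) (at u) \<and> 0 \<le> y"
    if u: "u\<^sub>0 \<le> u" "u < u\<^sub>s" and good: "13 * \<epsilon> / \<omega> < \<eta> u" for u
  proof -
    have mem: "u \<in> {u\<^sub>0..u\<^sub>s}" using u by simp
    define y x' Y where "y = x u - a" and "x' = R' u / R u\<^sub>0" and "Y = y powr (- p - 1)"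
    have y: "0 < y" using xa[OF mem] by (simp add: y_def)
    have Y: "0 < Y" using y by (simp add: Y_def)
    have x_deriv: "(x has_real_derivative x') (at u)"
      unfolding x_def x'_def using R0 by (auto intro!: derivative_eq_intros R_deriv u)
    have y_deriv: "((\<lambda>s. (x s - a) powr k) has_real_derivative k * y powr (k - 1) * x') (at u)" for k
      using y unfolding y_def
      by (intro DERIV_chain2[OF has_real_derivative_powr]) (auto intro!: derivative_eq_intros x_deriv)
    have Yp: "y powr - p = y * Y"
      using y powr_mult_base[of y "- p - 1"] by (simp add: Y_def)
    define F' where "F' = 2 / R u\<^sub>0 * (M' u * x u * (y * Y) + M u * x' * (y * Y) - M u * x u * (p * Y * x'))
        + K * (2 / \<omega> * a * (- (\<omega> / 2) * (y * Y) * x') + a\<^sup>2 / p * (- p * Y * x'))"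
    have "(F has_real_derivative F') (at u)"
    proof -
      have 1: "((\<lambda>s. (x s - a) powr - p) has_real_derivative - p * Y * x') (at u)"
        using y_deriv[of "- p"] by (simp add: Y_def)
      have 2: "((\<lambda>s. (x s - a) powr - (\<omega> / 2)) has_real_derivative - (\<omega> / 2) * (y * Y) * x') (at u)"
      proof -
        have "- (\<omega> / 2) - 1 = - p" by (simp add: p_def)
        then show ?thesis using y_deriv[of "- (\<omega> / 2)"] Yp by simp
      qed
      show ?thesis
        unfolding F_def[abs_def] source_def p_def[symmetric] K_def[symmetric]
        by (rule derivative_eq_intros 1 2 x_deriv M_deriv[OF u] refl)+
           (simp add: F'_def Yp y_def[symmetric] K_def p_def[symmetric] algebra_simps)
    qed
    moreover have "0 \<le> F'"
    proof -
      have \<eta>0: "0 < \<eta> u" using good divide_nonneg_pos[of "13 * \<epsilon>" \<omega>] \<epsilon> \<omega> by linarith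
      have *: "- M' u \<le> - R' u / 2 * (a / y * (K + p * \<eta> u) + \<omega> / 2 * \<eta> u)"
        using ineq[OF u _ \<eta>0] good \<omega> by (simp add: y_def K_def p_def field_simps)
      have R'_eq: "R' u = R u\<^sub>0 * x'" using R0 by (simp add: x'_def)
      have M_u: "M u = R u\<^sub>0 / 2 * (x u * \<eta> u)" using M_eq[OF mem] R0 by (simp add: field_simps)
      have x_eq: "x u = y + a" by (simp add: y_def)
      have p0: "p \<noteq> 0" "\<omega> \<noteq> 0" "\<omega> = 2 * p - 2" using \<omega> by (simp_all add: p_def)
      \<comment> \<open>\<open>Z\<close> is the bracket of the differential inequality. All terms of
        \<open>F'\<close> collect into a positive multiple of
        \<open>M' - R' / 2 * Z\<close>.\<close>
      define Z where "Z = a / y * (K + p * \<eta> u) + \<omega> / 2 * \<eta> u"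
      have "F' = 2 / R u\<^sub>0 * x u * y * Y * M' u
          + Y * x' * (x u * \<eta> u * y - x u * \<eta> u * x u * p - K * a * y - K * a * a)"
        unfolding F'_def M_u using R0 p0(1,2) by (simp add: field_simps power2_eq_square)
      also have "x u * \<eta> u * y - x u * \<eta> u * x u * p - K * a * y - K * a * a = - (x u * y * Z)"
        using y unfolding x_eq p0(3) Z_def by (simp add: field_simps)
      also have "2 / R u\<^sub>0 * x u * y * Y * M' u + Y * x' * - (x u * y * Z)
          = 2 / R u\<^sub>0 * x u * y * Y * (M' u - R' u / 2 * Z)"
        unfolding R'_eq using R0 by (simp add: right_diff_distrib)
      also have "0 \<le> \<dots>"
        using *[folded Z_def] y Y R0 xa[OF mem] by (intro mult_nonneg_nonneg) auto
      finally show ?thesis .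
    qed
    ultimately show ?thesis by blast
  qed
  have x0: "x u\<^sub>0 = 1" using R0 by (simp add: x_def)
  have xs: "x u\<^sub>s = 3 * a" using R0 R_end by (simp add: x_def)
  \<comment> \<open>Compares \<open>F\<close> at \<open>u\<^sub>0\<close> and \<open>w\<close>; the
    source at \<open>x w\<close> is then replaced by its smaller value at \<open>3 * a\<close>,
    giving a lower bound uniform in \<open>w\<close>.\<close>
  have key: "weight \<omega> a 1 * (\<eta> u\<^sub>0 - g \<omega> \<delta>\<^sub>0) \<le> weight \<omega> a (x w) * \<eta> w"
    if w: "w \<in> {u\<^sub>0..u\<^sub>s}" and good: "\<And>u. u\<^sub>0 \<le> u \<Longrightarrow> u < w \<Longrightarrow> 13 * \<epsilon> / \<omega> < \<eta> u" for w
  proof -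
    have "F u\<^sub>0 \<le> F w"
    proof (rule DERIV_nonneg_imp_increasing_open[where f = F])
      fix t assume "u\<^sub>0 < t" "t < w"
      then show "\<exists>y. (F has_real_derivative y) (at t) \<and> 0 \<le> y"
        using w by (intro F_deriv good) auto
    qed (use w continuous_on_subset[OF cont_F] in auto)
    then have "weight \<omega> a 1 * \<eta> u\<^sub>0 - source \<omega> a 1 \<le> weight \<omega> a (x w) * \<eta> w - source \<omega> a (x w)"
      using F_eq[OF w] F_eq[of u\<^sub>0] u x0 by simp
    moreover have "source \<omega> a (3 * a) \<le> source \<omega> a (x w)"
      using x_range[OF w] a \<omega> by (intro source_mono) auto
    ultimately show ?thesis
      using source_diff by (simp add: right_diff_distrib)
  qed
  \<comment> \<open>The bootstrap closes because \<open>x w \<le> 1\<close> makes the current weight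
    at most the initial one, while the first threshold puts
    \<open>\<eta> u\<^sub>0 - g \<omega> \<delta>\<^sub>0\<close> strictly above
    \<open>13 * \<epsilon> / \<omega>\<close>.\<close>
  have good: "0 < \<eta> w - 13 * \<epsilon> / \<omega>" if "w \<in> {u\<^sub>0..u\<^sub>s}" for w
  proof (rule positive_continuation[OF _ _ that])
    show "continuous_on {u\<^sub>0..u\<^sub>s} (\<lambda>w. \<eta> w - 13 * \<epsilon> / \<omega>)"
      by (intro continuous_intros cont_\<eta>)
    fix w assume w: "w \<in> {u\<^sub>0..u\<^sub>s}"
      and IH: "\<And>u. u\<^sub>0 \<le> u \<Longrightarrow> u < w \<Longrightarrow> 0 < \<eta> u - 13 * \<epsilon> / \<omega>"
    have wx: "0 < weight \<omega> a (x w)" using x_range[OF w] a by (intro weight_pos) simp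
    have "weight \<omega> a (x w) * (13 * \<epsilon> / \<omega>) \<le> weight \<omega> a 1 * (13 * \<epsilon> / \<omega>)"
      using x_range[OF w] a \<omega> \<epsilon> by (intro mult_right_mono weight_mono) auto
    also have "\<dots> < weight \<omega> a 1 * (\<eta> u\<^sub>0 - g \<omega> \<delta>\<^sub>0)"
      using large weight_pos[of 1] x_range[of u\<^sub>0] x0 u a by (intro mult_strict_left_mono) auto
    also have "\<dots> \<le> weight \<omega> a (x w) * \<eta> w"
      using key[OF w] IH by auto
    finally have "13 * \<epsilon> / \<omega> < \<eta> w"
      using mult_less_cancel_left_pos[OF wx] by blast
    then show "0 < \<eta> w - 13 * \<epsilon> / \<omega>" by simp
  qed
  have "weight \<omega> a (3 * a) < weight \<omega> a 1 * (\<eta> u\<^sub>0 - g \<omega> \<delta>\<^sub>0)"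
    unfolding weight_3a
    using large weight_pos[of 1] x_range[of u\<^sub>0] x0 u a by (intro mult_strict_left_mono) auto
  also have "\<dots> \<le> weight \<omega> a (3 * a) * \<eta> u\<^sub>s"
    using key[of u\<^sub>s] good u xs by auto
  finally show ?thesis
    using weight_pos[of "3 * a"] a by simp
qed

end

section \<open>The field equations as ordinary differential equations\<close>

lemma has_dv_if_differentiable:
  "(\<lambda>s. f u s) differentiable (at v) \<Longrightarrow> ((\<lambda>s. f u s) has_vector_derivative dv f u v) (at v)"
  by (simp add: dv_def vector_derivative_works)

lemma has_du_if_differentiable:
  "(\<lambda>s. f s v) differentiable (at u) \<Longrightarrow> ((\<lambda>s. f s v) has_vector_derivative du f u v) (at u)"
  by (simp add: du_def vector_derivative_works)

text \<open>Carries an identity to the vertex of the cone, where \<open>r = 0\<close> and the field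
  equations are not imposed directly.\<close>

lemma eq_at_left_end:
  fixes f :: "real \<Rightarrow> real"
  assumes "a < b" "isCont f a" and eq: "\<And>v. a < v \<Longrightarrow> v \<le> b \<Longrightarrow> f v = c"
  shows "f a = c"
proof -
  have "(f \<longlongrightarrow> f a) (at_right a)"
    using assms(2) by (simp add: isCont_def filterlim_at_split)
  moreover have "eventually (\<lambda>v. f v = c) (at_right a)"
    using eventually_at_right_real[OF assms(1)] by eventually_elim (auto intro: eq)
  then have "(f \<longlongrightarrow> c) (at_right a)" by (rule tendsto_eventually)
  ultimately show ?thesis by (intro tendsto_unique[of "at_right a"]) auto
qed

text \<open>One product rule serves both null directions: \<open>h\<close> is differentiated by the
  wave equation for \<open>r\<close>, and \<open>k\<close>, the derivative of \<open>r\<close>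
  divided by \<open>\<Omega>\<^sup>2\<close>, by Raychaudhuri's equation.\<close>

lemma mass_derivative:
  fixes f h k :: "real \<Rightarrow> real"
  assumes "(f has_real_derivative f') (at x)" "(h has_real_derivative h') (at x)"
    "(k has_real_derivative k') (at x)"
  shows "((\<lambda>s. f s / 2 * (1 + 4 * h s * k s)) has_real_derivative
    f' / 2 * (1 + 4 * h x * k x) + f x / 2 * (4 * (h' * k x + h x * k'))) (at x)"
  by (auto intro!: derivative_eq_intros assms simp: field_simps)

context EMCSF_solution
begin

abbreviation (input) "S \<equiv> region \<union> outgoing_cone u\<^sub>0"
abbreviation (input) "Q \<equiv> charge r \<Omega> A"
abbreviation (input) "m \<equiv> hawking_mass r \<Omega>"
abbreviation (input) "D \<equiv> gauge_du e A \<phi>"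

section \<open>Position relative to the center, and positivity of \<open>r\<close>\<close>

lemma rectangle_mem: "u \<in> {u\<^sub>0..u\<^sub>s} \<Longrightarrow> v \<in> {v\<^sub>1..v\<^sub>2} \<Longrightarrow> (u, v) \<in> region"
  by (simp add: region_def)

lemma u_le_0: "u \<in> {u\<^sub>0..u\<^sub>s} \<Longrightarrow> u \<le> 0"
  using coordinates by auto

lemma \<gamma>_less: "u \<in> {u\<^sub>0..0} \<Longrightarrow> u < 0 \<Longrightarrow> \<gamma> u < v\<^sub>1"
  using center_curve coordinates strict_mono_onD[of "{u\<^sub>0..0}" \<gamma> u 0] by auto

lemma \<gamma>_le: "u \<in> {u\<^sub>0..0} \<Longrightarrow> \<gamma> u \<le> v\<^sub>1"
  using \<gamma>_less center_curve by (cases "u = 0") (auto simp: less_imp_le)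

lemma incoming_mem: "u \<in> {u\<^sub>0..0} \<Longrightarrow> (u, v\<^sub>1) \<in> initial_region u\<^sub>0 v\<^sub>1 \<gamma>"
  using \<gamma>_le by (simp add: initial_region_def)

lemma incoming_mem_region: "u \<in> {u\<^sub>0..0} \<Longrightarrow> (u, v\<^sub>1) \<in> region"
  using incoming_mem by (simp add: region_def)

lemma outgoing_mem: "0 \<le> v \<Longrightarrow> v \<le> v\<^sub>2 \<Longrightarrow> (u\<^sub>0, v) \<in> region"
  using coordinates center_curve by (auto simp: region_def initial_region_def)

lemma cone_mem: "0 \<le> v \<Longrightarrow> (u\<^sub>0, v) \<in> outgoing_cone u\<^sub>0"
  by (simp add: outgoing_cone_def)

lemma r_pos_rectangle:
  assumes "u \<in> {u\<^sub>0..u\<^sub>s}" "v \<in> {v\<^sub>1..v\<^sub>2}" "u < 0 \<or> v\<^sub>1 < v"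
  shows "0 < r u v"
proof (rule radius_pos)
  have u: "u \<in> {u\<^sub>0..0}" using assms coordinates by auto
  have "\<gamma> u \<noteq> v" using assms \<gamma>_less[OF u] \<gamma>_le[OF u] by auto
  then show "(u, v) \<in> S - center u\<^sub>0 \<gamma>"
    using rectangle_mem assms by (auto simp: center_def)
qed

lemma r_pos_cone:
  assumes "0 < v" shows "0 < r u\<^sub>0 v"
  using assms center_curve by (intro radius_pos) (auto simp: center_def cone_mem)

lemma r_vertex: "r u\<^sub>0 0 = 0"
  using center_curve coordinates by (intro radius_center) (auto simp: center_def intro!: image_eqI[of _ _ u\<^sub>0])

section \<open>Derivatives along the null directions, from smoothness and the system\<close>

lemmas smooth_r = smooth(1) and smooth_\<Omega> = smooth(2) and smooth_A = smooth(3) and smooth_\<phi> = smooth(4)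

lemma real_dv: "smooth_near S f \<Longrightarrow> (u, v) \<in> S \<Longrightarrow> ((\<lambda>s. f u s) has_real_derivative dv f u v) (at v)"
  by (simp add: smooth_near_has_dv has_real_derivative_iff_has_vector_derivative)

lemma real_du: "smooth_near S f \<Longrightarrow> (u, v) \<in> S \<Longrightarrow> ((\<lambda>s. f s v) has_real_derivative du f u v) (at u)"
  by (simp add: smooth_near_has_du has_real_derivative_iff_has_vector_derivative)

lemma differentiable_dv: "smooth_near S f \<Longrightarrow> (u, v) \<in> S \<Longrightarrow> (\<lambda>s. f u s) differentiable (at v)"
  using smooth_near_has_dv differentiableI_vector by blast

lemma differentiable_du: "smooth_near S f \<Longrightarrow> (u, v) \<in> S \<Longrightarrow> (\<lambda>s. f s v) differentiable (at u)"
  using smooth_near_has_du differentiableI_vector by blast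

text \<open>The constraint only fixes the value of the total operator \<open>dv\<close>;
  differentiability comes from smoothness. Assuming the constraint rather than membership in
  \<open>region\<close> covers the part of \<open>C\<close> beyond \<open>v\<^sub>2\<close>.\<close>

lemma z_dv:
  assumes p: "(u, v) \<in> S" "0 < r u v" and "outgoing_constraints e r \<Omega> A \<phi> u v"
  shows "((\<lambda>s. dv r u s / (\<Omega> u s)\<^sup>2) has_real_derivative
    - (4 * pi * r u v / (\<Omega> u v)\<^sup>2 * (cmod (dv \<phi> u v))\<^sup>2)) (at v)"
proof -
  have "(\<lambda>s. dv r u s / (\<Omega> u s)\<^sup>2) differentiable (at v)"
    using p lapse_pos[OF p(1)]
    by (intro differentiable_divide differentiable_power differentiable_dv smooth smooth_near_dv) auto
  from has_dv_if_differentiable[of "\<lambda>u s. dv r u s / (\<Omega> u s)\<^sup>2", OF this] assms(3)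
  show ?thesis
    by (simp add: outgoing_constraints_def has_real_derivative_iff_has_vector_derivative)
qed

lemma Q_dv:
  assumes p: "(u, v) \<in> S" "0 < r u v" and "outgoing_constraints e r \<Omega> A \<phi> u v"
  shows "((\<lambda>s. Q u s) has_real_derivative
    - (4 * pi * e * (r u v)\<^sup>2 * Im (cnj (\<phi> u v) * dv \<phi> u v))) (at v)"
proof -
  have "(\<lambda>s. Q u s) differentiable (at v)"
    unfolding charge_def using p lapse_pos[OF p(1)]
    by (intro differentiable_minus differentiable_mult differentiable_divide differentiable_power
        differentiable_dv smooth smooth_near_dv differentiable_const) auto
  from has_dv_if_differentiable[of Q, OF this] assms(3)
  show ?thesis
    by (simp add: outgoing_constraints_def has_real_derivative_iff_has_vector_derivative)
qed

lemma \<kappa>_du: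
  assumes p: "(u, v) \<in> region" "0 < r u v"
  shows "((\<lambda>s. du r s v / (\<Omega> s v)\<^sup>2) has_real_derivative
    - (4 * pi * r u v / (\<Omega> u v)\<^sup>2 * (cmod (D u v))\<^sup>2)) (at u)"
proof -
  have S: "(u, v) \<in> S" using p by simp
  have "(\<lambda>s. du r s v / (\<Omega> s v)\<^sup>2) differentiable (at u)"
    using lapse_pos[OF S] S
    by (intro differentiable_divide differentiable_power differentiable_du smooth smooth_near_du) auto
  from has_du_if_differentiable[of "\<lambda>s v. du r s v / (\<Omega> s v)\<^sup>2", OF this] system[OF p]
  show ?thesis
    by (simp add: EMCSF_system_def Let_def has_real_derivative_iff_has_vector_derivative)
qed

lemma constraints_region:
  "(u, v) \<in> region \<Longrightarrow> 0 < r u v \<Longrightarrow> outgoing_constraints e r \<Omega> A \<phi> u v"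
  using system by (simp add: EMCSF_system_def Let_def)

text \<open>The bracket \<open>1 - Q\<^sup>2 / r\<^sup>2\<close> and the product of first
  derivatives combine to \<open>2 * m / r - Q\<^sup>2 / r\<^sup>2\<close>, by the definition of the
  Hawking mass.\<close>

lemma r_wave:
  assumes p: "(u, v) \<in> region" "0 < r u v"
  shows "dv (du r) u v = - ((\<Omega> u v)\<^sup>2 / (4 * (r u v)\<^sup>2) * (2 * m u v - (Q u v)\<^sup>2 / r u v))"
proof -
  have \<Omega>: "0 < \<Omega> u v" using p lapse_pos by auto
  have "r u v * dv (du r) u v = - ((\<Omega> u v)\<^sup>2 / 4) * (1 - (Q u v)\<^sup>2 / (r u v)\<^sup>2) - dv r u v * du r u v"
    using system[OF p] by (simp add: EMCSF_system_def Let_def)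
  then have "dv (du r) u v = (- ((\<Omega> u v)\<^sup>2 / 4) * (1 - (Q u v)\<^sup>2 / (r u v)\<^sup>2) - dv r u v * du r u v) / r u v"
    using p by (simp add: field_simps)
  also have "\<dots> = - ((\<Omega> u v)\<^sup>2 / (4 * (r u v)\<^sup>2) * (2 * m u v - (Q u v)\<^sup>2 / r u v))"
    using p \<Omega> by (simp add: hawking_mass_def field_simps power2_eq_square)
  finally show ?thesis .
qed

text \<open>Inserting \<open>r_wave\<close> cancels the terms in the mass itself; the matter term
  comes from Raychaudhuri's equation and the other from the charge.\<close>

lemma m_dv:
  assumes p: "(u, v) \<in> region" "0 < r u v"
  shows "((\<lambda>s. m u s) has_real_derivative
    8 * pi * (r u v)\<^sup>2 * (- du r u v / (\<Omega> u v)\<^sup>2) * (cmod (dv \<phi> u v))\<^sup>2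
      + dv r u v * ((Q u v)\<^sup>2 / (2 * (r u v)\<^sup>2))) (at v)"
proof -
  have S: "(u, v) \<in> S" using p by simp
  have \<Omega>: "0 < \<Omega> u v" using lapse_pos[OF S] .
  note wave = r_wave[OF p]
  let ?z' = "- (4 * pi * r u v / (\<Omega> u v)\<^sup>2 * (cmod (dv \<phi> u v))\<^sup>2)"
  have "((\<lambda>s. r u s / 2 * (1 + 4 * du r u s * (dv r u s / (\<Omega> u s)\<^sup>2))) has_real_derivative
      dv r u v / 2 * (1 + 4 * du r u v * (dv r u v / (\<Omega> u v)\<^sup>2))
      + r u v / 2 * (4 * (dv (du r) u v * (dv r u v / (\<Omega> u v)\<^sup>2) + du r u v * ?z'))) (at v)"
    by (rule mass_derivative[OF real_dv[OF smooth_r S] real_dv[OF smooth_near_du[OF smooth_r] S]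
        z_dv[OF S p(2) constraints_region[OF p]]])
  moreover have "(\<lambda>s. r u s / 2 * (1 + 4 * du r u s * (dv r u s / (\<Omega> u s)\<^sup>2))) = (\<lambda>s. m u s)"
    by (simp add: hawking_mass_def)
  moreover have "dv r u v / 2 * (1 + 4 * du r u v * (dv r u v / (\<Omega> u v)\<^sup>2))
      + r u v / 2 * (4 * (dv (du r) u v * (dv r u v / (\<Omega> u v)\<^sup>2) + du r u v * ?z'))
    = 8 * pi * (r u v)\<^sup>2 * (- du r u v / (\<Omega> u v)\<^sup>2) * (cmod (dv \<phi> u v))\<^sup>2
      + dv r u v * ((Q u v)\<^sup>2 / (2 * (r u v)\<^sup>2))"
    unfolding wave hawking_mass_def using p \<Omega> by (simp add: field_simps power2_eq_square)
  ultimately show ?thesis by simp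
qed

lemma m_du:
  assumes p: "(u, v) \<in> region" "0 < r u v"
  shows "((\<lambda>s. m s v) has_real_derivative
    - (8 * pi * (dv r u v / (\<Omega> u v)\<^sup>2) * (cmod (of_real (r u v) * D u v))\<^sup>2
      + - du r u v * (Q u v)\<^sup>2 / (2 * (r u v)\<^sup>2))) (at u)"
proof -
  have S: "(u, v) \<in> S" using p by simp
  have \<Omega>: "0 < \<Omega> u v" using lapse_pos[OF S] .
  have wave: "du (dv r) u v = - ((\<Omega> u v)\<^sup>2 / (4 * (r u v)\<^sup>2) * (2 * m u v - (Q u v)\<^sup>2 / r u v))"
    using r_wave[OF p] smooth_near_du_dv_commute[OF smooth_r S] by simp
  let ?k' = "- (4 * pi * r u v / (\<Omega> u v)\<^sup>2 * (cmod (D u v))\<^sup>2)"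
  have "((\<lambda>s. r s v / 2 * (1 + 4 * dv r s v * (du r s v / (\<Omega> s v)\<^sup>2))) has_real_derivative
      du r u v / 2 * (1 + 4 * dv r u v * (du r u v / (\<Omega> u v)\<^sup>2))
      + r u v / 2 * (4 * (du (dv r) u v * (du r u v / (\<Omega> u v)\<^sup>2) + dv r u v * ?k'))) (at u)"
    by (rule mass_derivative[OF real_du[OF smooth_r S] real_du[OF smooth_near_dv[OF smooth_r] S]
        \<kappa>_du[OF p]])
  moreover have "(\<lambda>s. r s v / 2 * (1 + 4 * dv r s v * (du r s v / (\<Omega> s v)\<^sup>2))) = (\<lambda>s. m s v)"
    by (simp add: hawking_mass_def mult_ac)
  moreover have "du r u v / 2 * (1 + 4 * dv r u v * (du r u v / (\<Omega> u v)\<^sup>2))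
      + r u v / 2 * (4 * (du (dv r) u v * (du r u v / (\<Omega> u v)\<^sup>2) + dv r u v * ?k'))
    = - (8 * pi * (dv r u v / (\<Omega> u v)\<^sup>2) * (cmod (of_real (r u v) * D u v))\<^sup>2
      + - du r u v * (Q u v)\<^sup>2 / (2 * (r u v)\<^sup>2))"
    unfolding wave hawking_mass_def norm_mult using p \<Omega> by (simp add: field_simps power2_eq_square)
  ultimately show ?thesis by simp
qed

text \<open>The product rule assembles the wave equation for \<phi>, up to charge terms. With
  \<open>a\<close> as below, the derivative of \<open>A\<close> contributes \<open>- 2 * a\<close>
  and the wave equation \<open>+ a\<close>, each times \<open>\<i> * e * \<phi>\<close>, leaving a
  single \<open>- a\<close>.\<close>

lemma rD_dv:
  assumes p: "(u, v) \<in> region" "0 < r u v"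
  shows "((\<lambda>s. of_real (r u s) * D u s) has_vector_derivative
    of_real (- du r u v) * dv \<phi> u v
      - \<i> * of_real (e * (\<Omega> u v)\<^sup>2 * Q u v / (4 * r u v)) * \<phi> u v) (at v)"
proof -
  have S: "(u, v) \<in> S" using p by simp
  have \<Omega>: "0 < \<Omega> u v" using lapse_pos[OF S] .
  have r_v: "((\<lambda>s. complex_of_real (r u s)) has_vector_derivative of_real (dv r u v)) (at v)"
    by (rule has_vector_derivative_of_real[OF real_dv[OF smooth_r S]])
  have A_v: "((\<lambda>s. complex_of_real (A u s)) has_vector_derivative of_real (dv A u v)) (at v)"
    by (rule has_vector_derivative_of_real[OF real_dv[OF smooth_A S]])
  have \<phi>_v: "((\<lambda>s. \<phi> u s) has_vector_derivative dv \<phi> u v) (at v)"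
    by (rule smooth_near_has_dv[OF smooth_\<phi> S])
  have \<phi>_uv: "((\<lambda>s. du \<phi> u s) has_vector_derivative dv (du \<phi>) u v) (at v)"
    by (rule smooth_near_has_dv[OF smooth_near_du[OF smooth_\<phi>] S])
  have "dv (\<lambda>u v. of_real (r u v) * \<phi> u v) u v = of_real (r u v) * dv \<phi> u v + of_real (dv r u v) * \<phi> u v"
    by (rule has_dv_eq) (rule has_vector_derivative_mult[OF r_v \<phi>_v])
  then have wave: "of_real (r u v) * dv (du \<phi>) u v + of_real (du r u v) * dv \<phi> u v
      + of_real (dv r u v) * du \<phi> u v + of_real e * \<i> * (of_real (A u v)
        * (of_real (r u v) * dv \<phi> u v + of_real (dv r u v) * \<phi> u v)
        - of_real ((\<Omega> u v)\<^sup>2 / 4 * (Q u v / r u v)) * \<phi> u v) = 0"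
    using system[OF p] smooth_near_du_dv_commute[OF smooth_\<phi> S]
    by (simp add: EMCSF_system_def Let_def)
  have A_eq: "dv A u v = - (Q u v * (\<Omega> u v)\<^sup>2 / (2 * (r u v)\<^sup>2))"
    using p \<Omega> by (simp add: charge_def)
  have "((\<lambda>s. of_real (r u s) * D u s) has_vector_derivative
      of_real (r u v) * (dv (du \<phi>) u v
        + \<i> * of_real e * (of_real (A u v) * dv \<phi> u v + of_real (dv A u v) * \<phi> u v))
      + of_real (dv r u v) * D u v) (at v)"
    unfolding gauge_du_def of_real_mult
    by (rule has_vector_derivative_eq_rhs,
        rule has_vector_derivative_mult[OF r_v has_vector_derivative_add[OF \<phi>_uv
          has_vector_derivative_mult[OF has_vector_derivative_mult[OF has_vector_derivative_const
            has_vector_derivative_mult[OF has_vector_derivative_const A_v]] \<phi>_v]]])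
       (simp add: algebra_simps)
  moreover have "of_real (r u v) * (dv (du \<phi>) u v
        + \<i> * of_real e * (of_real (A u v) * dv \<phi> u v + of_real (dv A u v) * \<phi> u v))
      + of_real (dv r u v) * D u v
    = of_real (- du r u v) * dv \<phi> u v
      - \<i> * of_real (e * (\<Omega> u v)\<^sup>2 * Q u v / (4 * r u v)) * \<phi> u v"
  proof -
    define a where "a = (\<Omega> u v)\<^sup>2 / 4 * (Q u v / r u v)"
    have "r u v * dv A u v = - (2 * a)" "e * (\<Omega> u v)\<^sup>2 * Q u v / (4 * r u v) = e * a"
      using p by (simp_all add: A_eq a_def field_simps power2_eq_square)
    note a = this(2) arg_cong[OF this(1), of complex_of_real, unfolded of_real_mult of_real_minus]
    show ?thesis
      using wave unfolding a_def[symmetric] a(1) gauge_du_def of_real_mult of_real_minus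
      using a(2) by (simp add: algebra_simps)
  qed
  ultimately show ?thesis by simp
qed

subsection \<open>Initial cones\<close>

lemma cone_sub: "0 \<le> v \<Longrightarrow> (u\<^sub>0, v) \<in> S"
  by (simp add: cone_mem)

lemma \<Omega>_cone: "0 \<le> v \<Longrightarrow> \<Omega> u\<^sub>0 v = 1"
  using lapse_normalized[of u\<^sub>0 v] lapse_pos[of u\<^sub>0 v] cone_mem[of v]
  by (auto simp: power2_eq_1_iff)

lemma r_cone_eq:
  assumes "0 < v" "v \<le> v\<^sub>2"
  shows "r u\<^sub>0 v * dv (du r) u\<^sub>0 v + dv r u\<^sub>0 v * du r u\<^sub>0 v = - (1 / 4) * (1 - (Q u\<^sub>0 v)\<^sup>2 / (r u\<^sub>0 v)\<^sup>2)"
  using system[OF outgoing_mem r_pos_cone] assms by (simp add: EMCSF_system_def Let_def \<Omega>_cone)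

text \<open>
  The limit of the wave equation for \<open>r\<close> at the vertex fixes the scale of \<open>v\<close>: there \<open>Q / r\<close> vanishes,
  so \<open>\<partial>\<^sub>u r \<partial>\<^sub>v r = - 1 / 4\<close>.
\<close>

lemma dv_r_vertex: "dv r u\<^sub>0 0 = 1 / 2"
proof -
  have S: "(u\<^sub>0, 0) \<in> S" by (rule cone_sub) simp
  have cont: "isCont (\<lambda>v. f u\<^sub>0 v) 0" if "smooth_near S f" for f :: "real \<Rightarrow> real \<Rightarrow> real"
    using real_dv[OF that S] by (rule DERIV_isCont)
  \<comment> \<open>On the cone \<open>Q\<^sup>2 / r\<^sup>2\<close> is four times
    \<open>r\<^sup>2 * (dv A)\<^sup>2\<close>, an expression that is continuous at the vertex and
    vanishes there.\<close>
  let ?f = "\<lambda>v. r u\<^sub>0 v * dv (du r) u\<^sub>0 v + dv r u\<^sub>0 v * du r u\<^sub>0 v - (r u\<^sub>0 v)\<^sup>2 * (dv A u\<^sub>0 v)\<^sup>2"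
  have "?f 0 = - (1 / 4)"
  proof (rule eq_at_left_end[of 0 v\<^sub>2])
    show "isCont ?f 0"
      by (intro continuous_intros cont smooth smooth_near_du smooth_near_dv)
    fix v assume v: "0 < v" "v \<le> v\<^sub>2"
    have "(Q u\<^sub>0 v)\<^sup>2 / (r u\<^sub>0 v)\<^sup>2 = 4 * ((r u\<^sub>0 v)\<^sup>2 * (dv A u\<^sub>0 v)\<^sup>2)"
      using v r_pos_cone[of v] by (simp add: charge_def \<Omega>_cone field_simps power2_eq_square)
    then show "?f v = - (1 / 4)"
      using r_cone_eq[OF v] by (simp add: diff_divide_distrib)
  qed (use coordinates in simp)
  then have sq: "(dv r u\<^sub>0 0)\<^sup>2 = (1 / 2)\<^sup>2"
    using vertex_normalized by (simp add: r_vertex power2_eq_square)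
  \<comment> \<open>The wave equation fixes only the square; the sign follows since \<open>r\<close>
    grows from 0 to positive values along \<open>C\<close>.\<close>
  have "0 \<le> dv r u\<^sub>0 0"
  proof (rule ccontr)
    assume "\<not> 0 \<le> dv r u\<^sub>0 0"
    then obtain d where "0 < d" "\<And>h. 0 < h \<Longrightarrow> h < d \<Longrightarrow> r u\<^sub>0 (0 + h) < r u\<^sub>0 0"
      using DERIV_neg_dec_right[OF real_dv[OF smooth_r S]] by auto
    then have "r u\<^sub>0 (d / 2) < 0" using r_vertex by (metis add_0 field_sum_of_halves half_gt_zero less_add_same_cancel2)
    then show False using r_pos_cone[of "d / 2"] \<open>0 < d\<close> by simp
  qed
  then show ?thesis using sq power2_eq_iff_nonneg[of "dv r u\<^sub>0 0" "1 / 2"] by simp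
qed

lemma dv_r_cone_le:
  assumes "0 \<le> v" shows "dv r u\<^sub>0 v \<le> 1 / 2"
proof -
  have "dv r u\<^sub>0 v / (\<Omega> u\<^sub>0 v)\<^sup>2 \<le> dv r u\<^sub>0 0 / (\<Omega> u\<^sub>0 0)\<^sup>2"
  proof (rule DERIV_nonpos_imp_decreasing_open[where f = "\<lambda>v. dv r u\<^sub>0 v / (\<Omega> u\<^sub>0 v)\<^sup>2"])
    fix t assume t: "0 < t" "t < v"
    show "\<exists>y. ((\<lambda>v. dv r u\<^sub>0 v / (\<Omega> u\<^sub>0 v)\<^sup>2) has_real_derivative y) (at t) \<and> y \<le> 0"
      using z_dv[OF cone_sub r_pos_cone constraints[OF cone_mem r_pos_cone], of t] t r_pos_cone[of t]
      by (intro exI conjI) auto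
  next
    show "continuous_on {0..v} (\<lambda>v. dv r u\<^sub>0 v / (\<Omega> u\<^sub>0 v)\<^sup>2)"
    proof (intro continuous_at_imp_continuous_on ballI)
      fix t assume "t \<in> {0..v}"
      then have t: "0 \<le> t" by simp
      show "isCont (\<lambda>v. dv r u\<^sub>0 v / (\<Omega> u\<^sub>0 v)\<^sup>2) t"
        using real_dv[OF smooth_near_dv[OF smooth_r] cone_sub[OF t], THEN DERIV_isCont]
          real_dv[OF smooth_\<Omega> cone_sub[OF t], THEN DERIV_isCont] \<Omega>_cone[OF t]
        by (intro continuous_intros) auto
    qed
  qed (use assms in simp)
  then show ?thesis using assms by (simp add: \<Omega>_cone dv_r_vertex)
qed

lemma r_cone_le:
  assumes "0 \<le> v" shows "r u\<^sub>0 v \<le> v / 2"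
proof -
  have "0 / 2 - r u\<^sub>0 0 \<le> v / 2 - r u\<^sub>0 v"
  proof (rule DERIV_nonneg_imp_nondecreasing[OF assms, where f = "\<lambda>v. v / 2 - r u\<^sub>0 v"])
    fix t :: real assume t: "0 \<le> t"
    have "((\<lambda>v. v / 2 - r u\<^sub>0 v) has_real_derivative 1 / 2 - dv r u\<^sub>0 t) (at t)"
      by (auto intro!: derivative_eq_intros real_dv[OF smooth_r cone_sub[OF t]])
    then show "\<exists>y. ((\<lambda>v. v / 2 - r u\<^sub>0 v) has_real_derivative y) (at t) \<and> 0 \<le> y"
      using dv_r_cone_le[OF t] by auto
  qed
  then show ?thesis by (simp add: r_vertex)
qed

text \<open>On \<open>C\<close> the wave equation says that \<open>r * du r\<close> has
  \<open>v\<close>-derivative at most \<open>- (1 - \<epsilon>) / 4\<close>. Integrate from the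
  vertex, where \<open>r = 0\<close>, and divide by \<open>r \<le> v / 2\<close>.\<close>

lemma du_r_cone_le:
  assumes \<epsilon>: "\<epsilon> < 1" and Q_le: "\<And>v. 0 < v \<Longrightarrow> (Q u\<^sub>0 v)\<^sup>2 / (r u\<^sub>0 v)\<^sup>2 \<le> \<epsilon>"
    and v: "0 < v" "v \<le> v\<^sub>2"
  shows "du r u\<^sub>0 v \<le> - ((1 - \<epsilon>) / 2)"
proof -
  let ?f = "\<lambda>v. r u\<^sub>0 v * du r u\<^sub>0 v + (1 - \<epsilon>) / 4 * v"
  have deriv: "(?f has_real_derivative
      r u\<^sub>0 t * dv (du r) u\<^sub>0 t + dv r u\<^sub>0 t * du r u\<^sub>0 t + (1 - \<epsilon>) / 4) (at t)" if t: "0 \<le> t" for t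
    by (auto intro!: derivative_eq_intros real_dv[OF smooth_r cone_sub[OF t]]
        real_dv[OF smooth_near_du[OF smooth_r] cone_sub[OF t]])
  have "?f v \<le> ?f 0"
  proof (rule DERIV_nonpos_imp_decreasing_open[where f = ?f])
    fix t assume t: "0 < t" "t < v"
    have "r u\<^sub>0 t * dv (du r) u\<^sub>0 t + dv r u\<^sub>0 t * du r u\<^sub>0 t + (1 - \<epsilon>) / 4 \<le> 0"
      using r_cone_eq[OF t(1)] Q_le[OF t(1)] t v by simp argo
    then show "\<exists>y. (?f has_real_derivative y) (at t) \<and> y \<le> 0"
      using deriv[of t] t by (intro exI conjI) auto
  next
    show "continuous_on {0..v} ?f"
      by (intro continuous_at_imp_continuous_on ballI DERIV_isCont[OF deriv]) auto
  qed (use v in simp)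
  then have "r u\<^sub>0 v * du r u\<^sub>0 v \<le> - ((1 - \<epsilon>) / 4 * v)" by (simp add: r_vertex)
  also have "(1 - \<epsilon>) / 4 * (2 * r u\<^sub>0 v) \<le> (1 - \<epsilon>) / 4 * v"
    using r_cone_le[of v] v \<epsilon> by (intro mult_left_mono) auto
  then have "- ((1 - \<epsilon>) / 4 * v) \<le> r u\<^sub>0 v * - ((1 - \<epsilon>) / 2)" by simp
  finally show ?thesis using r_pos_cone[OF v(1)] mult_le_cancel_left_pos by blast
qed

text \<open>Raychaudhuri's equation in \<open>u\<close> makes \<open>du r / \<Omega>\<^sup>2\<close>
  nonincreasing, which carries the bound on \<open>C\<close> into the rectangle.\<close>

lemma du_r_rectangle_le:
  assumes \<epsilon>: "\<epsilon> < 1" and Q_le: "\<And>v. 0 < v \<Longrightarrow> (Q u\<^sub>0 v)\<^sup>2 / (r u\<^sub>0 v)\<^sup>2 \<le> \<epsilon>"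
    and u: "u \<in> {u\<^sub>0..u\<^sub>s}" and v: "v \<in> {v\<^sub>1..v\<^sub>2}"
  shows "(1 - \<epsilon>) / 2 * (\<Omega> u v)\<^sup>2 \<le> - du r u v"
proof -
  have v0: "0 < v" using v coordinates by auto
  have sub: "(s, v) \<in> S" if "u\<^sub>0 \<le> s" "s \<le> u" for s
    using that u v rectangle_mem[of s v] by auto
  have "du r u v / (\<Omega> u v)\<^sup>2 \<le> du r u\<^sub>0 v / (\<Omega> u\<^sub>0 v)\<^sup>2"
  proof (rule DERIV_nonpos_imp_decreasing_open[where f = "\<lambda>s. du r s v / (\<Omega> s v)\<^sup>2"])
    fix s assume s: "u\<^sub>0 < s" "s < u"
    then have su: "s \<in> {u\<^sub>0..u\<^sub>s}" "s < 0" using u u_le_0[OF u] by auto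
    have rpos: "0 < r s v" using r_pos_rectangle[OF su(1) v] su(2) by simp
    show "\<exists>y. ((\<lambda>s. du r s v / (\<Omega> s v)\<^sup>2) has_real_derivative y) (at s) \<and> y \<le> 0"
      using \<kappa>_du[OF rectangle_mem[OF su(1) v] rpos] rpos by (intro exI conjI) auto
  next
    show "continuous_on {u\<^sub>0..u} (\<lambda>s. du r s v / (\<Omega> s v)\<^sup>2)"
    proof (intro continuous_at_imp_continuous_on ballI)
      fix s assume "s \<in> {u\<^sub>0..u}"
      then have s: "(s, v) \<in> S" using sub by auto
      show "isCont (\<lambda>s. du r s v / (\<Omega> s v)\<^sup>2) s"
        using real_du[OF smooth_near_du[OF smooth_r] s, THEN DERIV_isCont]
          real_du[OF smooth_\<Omega> s, THEN DERIV_isCont] lapse_pos[OF s]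
        by (intro continuous_intros) auto
    qed
  qed (use u in simp)
  also have "\<dots> \<le> - ((1 - \<epsilon>) / 2)"
    using du_r_cone_le[OF \<epsilon> Q_le] v v0 by (simp add: \<Omega>_cone)
  finally have "du r u v / (\<Omega> u v)\<^sup>2 \<le> - ((1 - \<epsilon>) / 2)" .
  moreover have "0 < (\<Omega> u v)\<^sup>2" using lapse_pos[OF sub[of u]] u by simp
  ultimately show ?thesis by (simp add: pos_divide_le_eq)
qed

end

section \<open>Solutions without trapped surfaces\<close>

text \<open>The setting to be refuted: \<open>untrapped\<close> denies the conclusion, while
  \<epsilon> and \<open>L\<close> enter as upper bounds rather than as suprema.\<close>

locale untrapped_solution = EMCSF_solution +
  fixes \<epsilon> L \<omega> :: real
  assumes \<epsilon>_less: "\<epsilon> < 1"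
    and Q_sq_le: "(u, v) \<in> outgoing_cone u\<^sub>0 \<union> incoming_cone u\<^sub>0 v\<^sub>1 \<Longrightarrow> 0 < r u v \<Longrightarrow>
      (charge r \<Omega> A u v)\<^sup>2 / (r u v)\<^sup>2 \<le> \<epsilon>"
    and L_ge: "u \<in> {u\<^sub>0..0} \<Longrightarrow> r u v\<^sub>1 * (cmod (\<phi> u v\<^sub>1))\<^sup>2 \<le> L"
    and \<omega>: "0 < \<omega>" "\<omega> < 2 / 3"
    and small1: "9 * e\<^sup>2 / (4 * (1 - \<epsilon>)\<^sup>2) * (v\<^sub>2 - v\<^sub>1)\<^sup>2
           + 12 * pi * L * e\<^sup>2 / (1 - \<epsilon>) * (v\<^sub>2 - v\<^sub>1) \<le> \<omega> / 4"
    and small2: "u \<in> {u\<^sub>0..0} \<Longrightarrow> 45 * pi * e\<^sup>2 * (v\<^sub>2 - v\<^sub>1)\<^sup>2 / (pi * (1 - \<epsilon>)\<^sup>2)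
           + 160 * pi * e\<^sup>2 * r u\<^sub>0 v\<^sub>2 * ((v\<^sub>2 - v\<^sub>1) / (1 - \<epsilon>)) * (cmod (\<phi> u v\<^sub>1))\<^sup>2 \<le> 4 * \<omega>"
    and not_supercharged: "u \<in> {u\<^sub>0..0} \<Longrightarrow> \<bar>charge r \<Omega> A u v\<^sub>1\<bar> \<le> hawking_mass r \<Omega> u v\<^sub>1"
    and untrapped: "u \<in> {u\<^sub>0..u\<^sub>s} \<Longrightarrow> v \<in> {v\<^sub>1..v\<^sub>2} \<Longrightarrow> \<not> trapped_surface r u v"
begin

section \<open>Signs of the derivatives of \<open>r\<close> and monotonicity in
  \<open>u\<close>\<close>

lemma du_r_le:
  assumes "u \<in> {u\<^sub>0..u\<^sub>s}" "v \<in> {v\<^sub>1..v\<^sub>2}"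
  shows "(1 - \<epsilon>) / 2 * (\<Omega> u v)\<^sup>2 \<le> - du r u v"
proof (rule du_r_rectangle_le[OF \<epsilon>_less _ assms])
  show "(Q u\<^sub>0 v)\<^sup>2 / (r u\<^sub>0 v)\<^sup>2 \<le> \<epsilon>" if "0 < v" for v
    using that r_pos_cone by (intro Q_sq_le) (auto simp: cone_mem)
qed

lemma \<epsilon>_nonneg: "0 \<le> \<epsilon>"
  using Q_sq_le[of u\<^sub>0 v\<^sub>1] r_pos_cone[of v\<^sub>1] cone_mem[of v\<^sub>1] coordinates
  by (meson UnI1 divide_nonneg_nonneg less_imp_le order_trans zero_le_power2)

lemma \<Omega>_pos: "u \<in> {u\<^sub>0..u\<^sub>s} \<Longrightarrow> v \<in> {v\<^sub>1..v\<^sub>2} \<Longrightarrow> 0 < \<Omega> u v"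
  using lapse_pos rectangle_mem by blast

lemma du_r_neg:
  assumes "u \<in> {u\<^sub>0..u\<^sub>s}" "v \<in> {v\<^sub>1..v\<^sub>2}"
  shows "du r u v < 0"
proof -
  have "0 < (1 - \<epsilon>) / 2 * (\<Omega> u v)\<^sup>2" using \<Omega>_pos[OF assms] \<epsilon>_less by simp
  then show ?thesis using du_r_le[OF assms] by linarith
qed

lemma dv_r_nonneg:
  assumes "u \<in> {u\<^sub>0..u\<^sub>s}" "v \<in> {v\<^sub>1..v\<^sub>2}"
  shows "0 \<le> dv r u v"
  using untrapped[OF assms] du_r_neg[OF assms] by (simp add: trapped_surface_def)

lemma r_du_mono:
  assumes v: "v \<in> {v\<^sub>1..v\<^sub>2}" and su: "u\<^sub>0 \<le> s" "s \<le> u" "u \<le> u\<^sub>s"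
  shows "r u v \<le> r s v"
proof (rule DERIV_nonpos_imp_nonincreasing[OF su(2), where f = "\<lambda>u. r u v"])
  fix t assume "s \<le> t" "t \<le> u"
  then have t: "t \<in> {u\<^sub>0..u\<^sub>s}" using su by auto
  show "\<exists>y. ((\<lambda>u. r u v) has_real_derivative y) (at t) \<and> y \<le> 0"
    using real_du[OF smooth_r, of t v] rectangle_mem[OF t v] du_r_neg[OF t v] by (intro exI conjI) auto
qed

lemma r2_strict_mono:
  assumes su: "u\<^sub>0 \<le> s" "s < u" "u \<le> u\<^sub>s"
  shows "r u v\<^sub>2 < r s v\<^sub>2"
proof (rule DERIV_neg_imp_decreasing[OF su(2), where f = "\<lambda>u. r u v\<^sub>2"])
  fix t assume "s \<le> t" "t \<le> u"
  then have t: "t \<in> {u\<^sub>0..u\<^sub>s}" using su by auto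
  have v: "v\<^sub>2 \<in> {v\<^sub>1..v\<^sub>2}" using coordinates by simp
  show "\<exists>y. ((\<lambda>u. r u v\<^sub>2) has_real_derivative y) (at t) \<and> y < 0"
    using real_du[OF smooth_r, of t v\<^sub>2] rectangle_mem[OF t v] du_r_neg[OF t v] by (intro exI conjI) auto
qed

text \<open>The restriction \<open>u < 0\<close> keeps the slice off the center. The smallness
  conditions localize by \<open>r\<^sub>1 |\<phi>|\<^sup>2 \<le> L\<close> and by the decrease of
  \<open>r\<^sub>2\<close> in \<open>u\<close>.\<close>

lemma slice:
  assumes u: "u \<in> {u\<^sub>0..u\<^sub>s}" "u < 0" and r2_le: "r u v\<^sub>2 \<le> 3 / 2 * r u v\<^sub>1"
  shows "null_slice e \<epsilon> \<omega> v\<^sub>1 v\<^sub>2 (r u) (m u) (Q u) (\<lambda>v. (\<Omega> u v)\<^sup>2) (\<lambda>v. dv r u v / (\<Omega> u v)\<^sup>2)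
    (\<lambda>v. - du r u v) (\<phi> u) (dv \<phi> u) (\<lambda>v. of_real (r u v) * D u v)"
proof
  have u0: "u \<in> {u\<^sub>0..0}" using u by auto
  have reg: "(u, v) \<in> region" "(u, v) \<in> S" if "v \<in> {v\<^sub>1..v\<^sub>2}" for v
    using rectangle_mem[OF u(1) that] by auto
  have rp: "0 < r u v" if "v \<in> {v\<^sub>1..v\<^sub>2}" for v using r_pos_rectangle[OF u(1) that] u by simp
  note \<Omega>p = \<Omega>_pos[OF u(1)]
  have v1: "v\<^sub>1 \<in> {v\<^sub>1..v\<^sub>2}" and v2: "v\<^sub>2 \<in> {v\<^sub>1..v\<^sub>2}" and v12: "v\<^sub>1 < v\<^sub>2" using coordinates by auto
  show "v\<^sub>1 < v\<^sub>2" "0 < \<omega>" "\<omega> < 2 / 3" "0 \<le> \<epsilon>" "\<epsilon> < 1"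
    using coordinates \<omega> \<epsilon>_nonneg \<epsilon>_less by auto
  show "r u v\<^sub>2 \<le> 3 / 2 * r u v\<^sub>1" by (rule r2_le)
  show "\<bar>Q u v\<^sub>1\<bar> \<le> m u v\<^sub>1" by (rule not_supercharged[OF u0])
  have "(Q u v\<^sub>1)\<^sup>2 / (r u v\<^sub>1)\<^sup>2 \<le> \<epsilon>"
    using u0 rp[OF v1] by (intro Q_sq_le) (auto simp: incoming_cone_def)
  then show "(Q u v\<^sub>1)\<^sup>2 \<le> \<epsilon> * (r u v\<^sub>1)\<^sup>2"
    using rp[OF v1] by (simp add: pos_divide_le_eq)
  have "12 * pi * (r u v\<^sub>1 * (cmod (\<phi> u v\<^sub>1))\<^sup>2) * e\<^sup>2 / (1 - \<epsilon>) * (v\<^sub>2 - v\<^sub>1)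
      \<le> 12 * pi * L * e\<^sup>2 / (1 - \<epsilon>) * (v\<^sub>2 - v\<^sub>1)"
    using L_ge[OF u0] \<epsilon>_less v12
    by (intro mult_right_mono divide_right_mono mult_left_mono) auto
  then show "9 * e\<^sup>2 / (4 * (1 - \<epsilon>)\<^sup>2) * (v\<^sub>2 - v\<^sub>1)\<^sup>2
      + 12 * pi * (r u v\<^sub>1 * (cmod (\<phi> u v\<^sub>1))\<^sup>2) * e\<^sup>2 / (1 - \<epsilon>) * (v\<^sub>2 - v\<^sub>1) \<le> \<omega> / 4"
    using small1 by linarith
  have "160 * pi * e\<^sup>2 * r u v\<^sub>2 * ((v\<^sub>2 - v\<^sub>1) / (1 - \<epsilon>)) * (cmod (\<phi> u v\<^sub>1))\<^sup>2
      \<le> 160 * pi * e\<^sup>2 * r u\<^sub>0 v\<^sub>2 * ((v\<^sub>2 - v\<^sub>1) / (1 - \<epsilon>)) * (cmod (\<phi> u v\<^sub>1))\<^sup>2"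
    using r_du_mono[OF v2, of u\<^sub>0 u] u \<epsilon>_less v12
    by (intro mult_right_mono mult_left_mono divide_nonneg_nonneg) auto
  moreover have "45 * pi * e\<^sup>2 * (v\<^sub>2 - v\<^sub>1)\<^sup>2 / (pi * (1 - \<epsilon>)\<^sup>2) = 45 * e\<^sup>2 * (v\<^sub>2 - v\<^sub>1)\<^sup>2 / (1 - \<epsilon>)\<^sup>2"
    by simp
  ultimately show "45 * e\<^sup>2 * (v\<^sub>2 - v\<^sub>1)\<^sup>2 / (1 - \<epsilon>)\<^sup>2
      + 160 * pi * e\<^sup>2 * r u v\<^sub>2 * ((v\<^sub>2 - v\<^sub>1) / (1 - \<epsilon>)) * (cmod (\<phi> u v\<^sub>1))\<^sup>2 \<le> 4 * \<omega>"
    using small2[OF u0] by linarith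
  fix v assume v: "v \<in> {v\<^sub>1..v\<^sub>2}"
  note con = constraints_region[OF reg(1)[OF v] rp[OF v]]
  show "0 < r u v" by (rule rp[OF v])
  show "0 < (\<Omega> u v)\<^sup>2" using \<Omega>p[OF v] by simp
  show "0 \<le> dv r u v / (\<Omega> u v)\<^sup>2" using dv_r_nonneg[OF u(1) v] by simp
  show "(1 - \<epsilon>) / 2 * (\<Omega> u v)\<^sup>2 \<le> - du r u v" by (rule du_r_le[OF u(1) v])
  show "2 * m u v = r u v * (1 - 4 * - du r u v * (dv r u v / (\<Omega> u v)\<^sup>2))"
    by (simp add: hawking_mass_def)
  show "(r u has_real_derivative (\<Omega> u v)\<^sup>2 * (dv r u v / (\<Omega> u v)\<^sup>2)) (at v)"
    using real_dv[OF smooth_r reg(2)[OF v]] \<Omega>p[OF v] by simp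
  show "((\<lambda>v. dv r u v / (\<Omega> u v)\<^sup>2) has_real_derivative
      - (4 * pi * r u v / (\<Omega> u v)\<^sup>2 * (cmod (dv \<phi> u v))\<^sup>2)) (at v)"
    by (rule z_dv[OF reg(2)[OF v] rp[OF v] con])
  show "(m u has_real_derivative 8 * pi * (r u v)\<^sup>2 * (- du r u v / (\<Omega> u v)\<^sup>2) * (cmod (dv \<phi> u v))\<^sup>2
      + (\<Omega> u v)\<^sup>2 * (dv r u v / (\<Omega> u v)\<^sup>2) * ((Q u v)\<^sup>2 / (2 * (r u v)\<^sup>2))) (at v)"
    using m_dv[OF reg(1)[OF v] rp[OF v]] \<Omega>p[OF v] by simp
  show "((\<lambda>v. - du r u v) has_real_derivative
      (\<Omega> u v)\<^sup>2 / (4 * (r u v)\<^sup>2) * (2 * m u v - (Q u v)\<^sup>2 / r u v)) (at v)"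
    using DERIV_minus[OF real_dv[OF smooth_near_du[OF smooth_r] reg(2)[OF v]]]
    unfolding r_wave[OF reg(1)[OF v] rp[OF v]] by simp
  show "(Q u has_real_derivative - (4 * pi * e * (r u v)\<^sup>2 * Im (cnj (\<phi> u v) * dv \<phi> u v))) (at v)"
    by (rule Q_dv[OF reg(2)[OF v] rp[OF v] con])
  show "(\<phi> u has_vector_derivative dv \<phi> u v) (at v)"
    by (rule smooth_near_has_dv[OF smooth_\<phi> reg(2)[OF v]])
  show "((\<lambda>v. of_real (r u v) * D u v) has_vector_derivative of_real (- du r u v) * dv \<phi> u v
      - \<i> * of_real (e * (\<Omega> u v)\<^sup>2 * Q u v / (4 * r u v)) * \<phi> u v) (at v)"
    by (rule rD_dv[OF reg(1)[OF v] rp[OF v]])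
qed

text \<open>While the width is below \<open>r\<^sub>2 / 3\<close>, i.e.
  \<open>r\<^sub>2 < 3 / 2 * r\<^sub>1\<close>, \<open>n_mono\<close> makes it nonincreasing. It
  starts at a third of the final \<open>r\<^sub>2\<close>, and \<open>r\<^sub>2\<close> is strictly
  larger before \<open>u\<^sub>s\<close>, so the condition persists.\<close>

lemma width_le:
  assumes small: "r u\<^sub>0 v\<^sub>2 - r u\<^sub>0 v\<^sub>1 = r u\<^sub>s v\<^sub>2 / 3" and u: "u\<^sub>0 \<le> u" "u < u\<^sub>s"
  shows "r u v\<^sub>2 - r u v\<^sub>1 \<le> r u\<^sub>0 v\<^sub>2 - r u\<^sub>0 v\<^sub>1" "r u v\<^sub>2 \<le> 3 / 2 * r u v\<^sub>1"
proof -
  let ?w = "\<lambda>u. r u v\<^sub>2 - r u v\<^sub>1"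
  have v1: "v\<^sub>1 \<in> {v\<^sub>1..v\<^sub>2}" and v2: "v\<^sub>2 \<in> {v\<^sub>1..v\<^sub>2}" using coordinates by auto
  have deriv: "(?w has_real_derivative du r t v\<^sub>2 - du r t v\<^sub>1) (at t)" if t: "t \<in> {u\<^sub>0..u\<^sub>s}" for t
    using rectangle_mem[OF t v1] rectangle_mem[OF t v2]
    by (intro DERIV_diff real_du[OF smooth_r]) auto
  have cont: "continuous_on {u\<^sub>0..u} ?w"
    using u by (intro continuous_at_imp_continuous_on ballI DERIV_isCont[OF deriv]) auto
  have cont2: "continuous_on {u\<^sub>0..u} (\<lambda>t. r t v\<^sub>2)"
    using u rectangle_mem[OF _ v2]
    by (intro continuous_at_imp_continuous_on ballI DERIV_isCont[OF real_du[OF smooth_r]]) auto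
  have mono: "?w t \<le> ?w u\<^sub>0"
    if t: "u\<^sub>0 \<le> t" "t \<le> u" and IH: "\<And>s. u\<^sub>0 \<le> s \<Longrightarrow> s < t \<Longrightarrow> 0 < r s v\<^sub>2 / 3 - ?w s" for t
  proof (rule DERIV_nonpos_imp_decreasing_open[OF t(1), where f = ?w])
    fix s assume s: "u\<^sub>0 < s" "s < t"
    then have su: "s \<in> {u\<^sub>0..u\<^sub>s}" "s < 0" using t u u_le_0[of u\<^sub>s] coordinates by auto
    have "r s v\<^sub>2 \<le> 3 / 2 * r s v\<^sub>1" using IH[of s] s by simp
    then interpret null_slice e \<epsilon> \<omega> v\<^sub>1 v\<^sub>2 "r s" "m s" "Q s" "\<lambda>v. (\<Omega> s v)\<^sup>2" "\<lambda>v. dv r s v / (\<Omega> s v)\<^sup>2"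
      "\<lambda>v. - du r s v" "\<phi> s" "dv \<phi> s" "\<lambda>v. of_real (r s v) * D s v"
      by (rule slice[OF su])
    show "\<exists>y. (?w has_real_derivative y) (at s) \<and> y \<le> 0"
      using deriv[OF su(1)] n_mono[of v\<^sub>1 v\<^sub>2] coordinates by (intro exI conjI) auto
  qed (use t cont in \<open>auto intro: continuous_on_subset\<close>)
  have pos: "0 < r t v\<^sub>2 / 3 - ?w t" if "t \<in> {u\<^sub>0..u}" for t
  proof (rule positive_continuation[OF _ _ that])
    show "continuous_on {u\<^sub>0..u} (\<lambda>t. r t v\<^sub>2 / 3 - ?w t)"
      by (intro continuous_intros cont cont2) auto
    fix t assume t: "t \<in> {u\<^sub>0..u}" and IH: "\<And>s. u\<^sub>0 \<le> s \<Longrightarrow> s < t \<Longrightarrow> 0 < r s v\<^sub>2 / 3 - ?w s"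
    have "?w t \<le> r u\<^sub>s v\<^sub>2 / 3" using mono[OF _ _ IH] t small by simp
    also have "\<dots> < r t v\<^sub>2 / 3" using r2_strict_mono[of t u\<^sub>s] t u by auto
    finally show "0 < r t v\<^sub>2 / 3 - ?w t" by simp
  qed
  show "r u v\<^sub>2 - r u v\<^sub>1 \<le> r u\<^sub>0 v\<^sub>2 - r u\<^sub>0 v\<^sub>1"
    using mono[of u] pos u by auto
  show "r u v\<^sub>2 \<le> 3 / 2 * r u v\<^sub>1" using pos[of u] u by simp
qed

lemma mass_ratio_not_large:
  assumes \<delta>\<^sub>0: "\<delta>\<^sub>0 = r u\<^sub>0 v\<^sub>2 / r u\<^sub>0 v\<^sub>1 - 1"
    and us: "r u\<^sub>s v\<^sub>2 = 3 * \<delta>\<^sub>0 / (1 + \<delta>\<^sub>0) * r u\<^sub>0 v\<^sub>2"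
  shows "\<not> max (13 * \<epsilon> / \<omega> + g \<omega> \<delta>\<^sub>0)
      (9 / (2 powr (1 + \<omega> / 2) * (1 + \<delta>\<^sub>0)\<^sup>2) * \<delta>\<^sub>0 powr (1 - \<omega> / 2) + g \<omega> \<delta>\<^sub>0)
    < 2 * (m u\<^sub>0 v\<^sub>2 - m u\<^sub>0 v\<^sub>1) / r u\<^sub>0 v\<^sub>2"
proof
  assume large: "max (13 * \<epsilon> / \<omega> + g \<omega> \<delta>\<^sub>0)
      (9 / (2 powr (1 + \<omega> / 2) * (1 + \<delta>\<^sub>0)\<^sup>2) * \<delta>\<^sub>0 powr (1 - \<omega> / 2) + g \<omega> \<delta>\<^sub>0)
    < 2 * (m u\<^sub>0 v\<^sub>2 - m u\<^sub>0 v\<^sub>1) / r u\<^sub>0 v\<^sub>2"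
  define a where "a = \<delta>\<^sub>0 / (1 + \<delta>\<^sub>0)"
  have v1: "v\<^sub>1 \<in> {v\<^sub>1..v\<^sub>2}" and v2: "v\<^sub>2 \<in> {v\<^sub>1..v\<^sub>2}" and us_le: "u\<^sub>0 \<le> u\<^sub>s" "u\<^sub>s \<le> 0"
    using coordinates by auto
  have us_mem: "u\<^sub>s \<in> {u\<^sub>0..u\<^sub>s}" using us_le by simp
  have r10: "0 < r u\<^sub>0 v\<^sub>1" and r20: "0 < r u\<^sub>0 v\<^sub>2" using coordinates by (auto intro: r_pos_cone)
  have r2_pos: "0 < r u v\<^sub>2" if "u \<in> {u\<^sub>0..u\<^sub>s}" for u
    using r_pos_rectangle[OF that v2] coordinates by simp
  have ratio: "1 + \<delta>\<^sub>0 = r u\<^sub>0 v\<^sub>2 / r u\<^sub>0 v\<^sub>1" by (simp add: \<delta>\<^sub>0)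
  then have pos: "0 < 1 + \<delta>\<^sub>0" using r10 r20 by simp
  \<comment> \<open>Since \<open>v\<^sub>2 > v\<^sub>1\<close>, the outer radius is positive even at
    \<open>u\<^sub>s\<close>; its defining equation then forces
    \<open>\<delta>\<^sub>0 > 0\<close>.\<close>
  have "0 < 3 * \<delta>\<^sub>0 / (1 + \<delta>\<^sub>0)"
    using r2_pos[OF us_mem] r20 unfolding us by (rule zero_less_mult_pos2)
  then have \<delta>\<^sub>0_pos: "0 < \<delta>\<^sub>0" using pos by (simp add: zero_less_divide_iff)
  have a_pos: "0 < a" using \<delta>\<^sub>0_pos by (simp add: a_def)
  have width: "r u\<^sub>0 v\<^sub>2 - r u\<^sub>0 v\<^sub>1 = a * r u\<^sub>0 v\<^sub>2"
    unfolding a_def ratio unfolding \<delta>\<^sub>0 using r10 r20 by (simp add: field_simps)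
  have us_a: "r u\<^sub>s v\<^sub>2 = 3 * a * r u\<^sub>0 v\<^sub>2" by (simp add: us a_def)
  then have width3: "r u\<^sub>0 v\<^sub>2 - r u\<^sub>0 v\<^sub>1 = r u\<^sub>s v\<^sub>2 / 3" using width by simp
  let ?R = "\<lambda>u. r u v\<^sub>2"
  let ?M = "\<lambda>u. m u v\<^sub>2 - m u v\<^sub>1"
  let ?E = "\<lambda>u v. 8 * pi * (dv r u v / (\<Omega> u v)\<^sup>2) * (cmod (of_real (r u v) * D u v))\<^sup>2
      + - du r u v * (Q u v)\<^sup>2 / (2 * (r u v)\<^sup>2)"
  have S: "(u, v) \<in> S" if "u \<in> {u\<^sub>0..u\<^sub>s}" "v \<in> {v\<^sub>1..v\<^sub>2}" for u v
    using rectangle_mem[OF that] by simp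
  have cont_m: "continuous_on {u\<^sub>0..u\<^sub>s} (\<lambda>u. m u v)" if v: "v \<in> {v\<^sub>1..v\<^sub>2}" for v
  proof (intro continuous_at_imp_continuous_on ballI)
    fix u assume u: "u \<in> {u\<^sub>0..u\<^sub>s}"
    show "isCont (\<lambda>u. m u v) u"
      unfolding hawking_mass_def
      using real_du[OF smooth_r S[OF u v], THEN DERIV_isCont]
        real_du[OF smooth_\<Omega> S[OF u v], THEN DERIV_isCont]
        real_du[OF smooth_near_du[OF smooth_r] S[OF u v], THEN DERIV_isCont]
        real_du[OF smooth_near_dv[OF smooth_r] S[OF u v], THEN DERIV_isCont] \<Omega>_pos[OF u v]
      by (intro continuous_intros) auto
  qed
  have "1 < 2 * ?M u\<^sub>s / ?R u\<^sub>s"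
  proof (rule ratio_exceeds_one[OF \<omega> \<delta>\<^sub>0_pos a_def us_le(1) \<epsilon>_nonneg,
        where R = ?R and M = ?M and R' = "\<lambda>u. du r u v\<^sub>2" and M' = "\<lambda>u. - ?E u v\<^sub>2 - - ?E u v\<^sub>1"])
    show "0 < r u\<^sub>0 v\<^sub>2" by (rule r20)
    show "continuous_on {u\<^sub>0..u\<^sub>s} ?R"
      by (intro continuous_at_imp_continuous_on ballI DERIV_isCont[OF real_du[OF smooth_r S[OF _ v2]]])
    show "continuous_on {u\<^sub>0..u\<^sub>s} ?M"
      by (intro continuous_intros cont_m v1 v2)
    show "r u v\<^sub>2 \<le> r u\<^sub>0 v\<^sub>2" "r u\<^sub>s v\<^sub>2 \<le> r u v\<^sub>2" if "u \<in> {u\<^sub>0..u\<^sub>s}" for u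
      using that by (auto intro: r_du_mono[OF v2])
    show "r u\<^sub>s v\<^sub>2 = 3 * a * r u\<^sub>0 v\<^sub>2" by (rule us_a)
    fix u assume u: "u\<^sub>0 \<le> u" "u < u\<^sub>s"
    then have mem: "u \<in> {u\<^sub>0..u\<^sub>s}" "u < 0" using us_le by auto
    have r1: "0 < r u v\<^sub>1" and r2: "0 < r u v\<^sub>2"
      using r_pos_rectangle[OF mem(1)] mem(2) v1 v2 by auto
    show "(?R has_real_derivative du r u v\<^sub>2) (at u)"
      by (rule real_du[OF smooth_r S[OF mem(1) v2]])
    show "(?M has_real_derivative - ?E u v\<^sub>2 - - ?E u v\<^sub>1) (at u)"
      by (intro DERIV_diff m_du rectangle_mem mem(1) v1 v2 r1 r2)
    define x \<eta> \<delta> where "x = r u v\<^sub>2 / r u\<^sub>0 v\<^sub>2" and "\<eta> = 2 * ?M u / r u v\<^sub>2" and "\<delta> = r u v\<^sub>2 / r u v\<^sub>1 - 1"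
    assume good: "13 * \<epsilon> \<le> \<omega> * (2 * ?M u / r u v\<^sub>2)" "0 < 2 * ?M u / r u v\<^sub>2"
    interpret null_slice e \<epsilon> \<omega> v\<^sub>1 v\<^sub>2 "r u" "m u" "Q u" "\<lambda>v. (\<Omega> u v)\<^sup>2" "\<lambda>v. dv r u v / (\<Omega> u v)\<^sup>2"
      "\<lambda>v. - du r u v" "\<phi> u" "dv \<phi> u" "\<lambda>v. of_real (r u v) * D u v"
      by (rule slice[OF mem width_le(2)[OF width3 u]])
    have n2: "0 \<le> - du r u v\<^sub>2" using du_r_neg[OF mem(1) v2] by simp
    \<comment> \<open>The width never exceeds its initial value
      \<open>a * r u\<^sub>0 v\<^sub>2\<close>, so
      \<open>r\<^sub>1 \<ge> r\<^sub>2 - a * r u\<^sub>0 v\<^sub>2\<close>.\<close>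
    have "\<delta> \<le> a / (x - a)"
    proof -
      have "r u v\<^sub>2 - a * r u\<^sub>0 v\<^sub>2 \<le> r u v\<^sub>1" using width_le(1)[OF width3 u] width by simp
      moreover have lt: "0 < r u v\<^sub>2 - a * r u\<^sub>0 v\<^sub>2"
      proof -
        have "3 * a * r u\<^sub>0 v\<^sub>2 \<le> r u v\<^sub>2" using us_a r_du_mono[OF v2, of u u\<^sub>s] u by simp
        moreover have "0 < a * r u\<^sub>0 v\<^sub>2" using a_pos r20 by simp
        ultimately show ?thesis by simp
      qed
      ultimately have "r u v\<^sub>2 / r u v\<^sub>1 \<le> r u v\<^sub>2 / (r u v\<^sub>2 - a * r u\<^sub>0 v\<^sub>2)"
        using r1 r2 by (intro divide_left_mono) auto
      then have "\<delta> \<le> r u v\<^sub>2 / (r u v\<^sub>2 - a * r u\<^sub>0 v\<^sub>2) - 1" by (simp add: \<delta>_def)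
      also have "\<dots> = a * r u\<^sub>0 v\<^sub>2 / (r u v\<^sub>2 - a * r u\<^sub>0 v\<^sub>2)" using lt by (simp add: field_simps)
      also have "\<dots> = a / (x - a)"
        using lt r20 by (simp add: x_def field_simps)
      finally show ?thesis .
    qed
    then have "\<delta> * ((1 + \<omega> / 2) / (1 - \<omega> / 2) + (1 + \<omega> / 2) * \<eta>)
        \<le> a / (x - a) * ((1 + \<omega> / 2) / (1 - \<omega> / 2) + (1 + \<omega> / 2) * \<eta>)"
      using \<omega> good(2)[folded \<eta>_def] by (intro mult_right_mono add_nonneg_nonneg) auto
    then have "- du r u v\<^sub>2 / 2 * (\<delta> * ((1 + \<omega> / 2) / (1 - \<omega> / 2) + (1 + \<omega> / 2) * \<eta>) + \<omega> / 2 * \<eta>)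
        \<le> - du r u v\<^sub>2 / 2 * (a / (x - a) * ((1 + \<omega> / 2) / (1 - \<omega> / 2) + (1 + \<omega> / 2) * \<eta>) + \<omega> / 2 * \<eta>)"
      using n2 by (intro mult_left_mono add_right_mono) auto
    moreover have "8 * pi * (dv r u v\<^sub>2 / (\<Omega> u v\<^sub>2)\<^sup>2 * (cmod (of_real (r u v\<^sub>2) * D u v\<^sub>2))\<^sup>2
          - dv r u v\<^sub>1 / (\<Omega> u v\<^sub>1)\<^sup>2 * (cmod (of_real (r u v\<^sub>1) * D u v\<^sub>1))\<^sup>2)
        + - du r u v\<^sub>2 * (Q u v\<^sub>2)\<^sup>2 / (2 * (r u v\<^sub>2)\<^sup>2)
      \<le> - du r u v\<^sub>2 / 2 * (\<delta> * ((1 + \<omega> / 2) / (1 - \<omega> / 2) + (1 + \<omega> / 2) * \<eta>) + \<omega> / 2 * \<eta>)"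
      using flux_le[OF good] unfolding \<delta>_def \<eta>_def .
    \<comment> \<open>The charge term at \<open>v\<^sub>1\<close>, absent from
      \<open>flux_le\<close>, enters with the favourable sign.\<close>
    moreover have "0 \<le> - du r u v\<^sub>1 * (Q u v\<^sub>1)\<^sup>2 / (2 * (r u v\<^sub>1)\<^sup>2)"
      using du_r_neg[OF mem(1) v1] by (intro divide_nonneg_nonneg mult_nonneg_nonneg) auto
    moreover have "8 * pi * (p * b - q * c) = 8 * pi * p * b - 8 * pi * q * c" for p q b c :: real
      by (simp add: algebra_simps)
    ultimately have "- (- ?E u v\<^sub>2 - - ?E u v\<^sub>1) \<le> - du r u v\<^sub>2 / 2 *
        (a / (x - a) * ((1 + \<omega> / 2) / (1 - \<omega> / 2) + (1 + \<omega> / 2) * \<eta>) + \<omega> / 2 * \<eta>)"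
      by (simp only:)
    then show "- (- ?E u v\<^sub>2 - - ?E u v\<^sub>1) \<le> - du r u v\<^sub>2 / 2 *
        (a / (r u v\<^sub>2 / r u\<^sub>0 v\<^sub>2 - a) * ((1 + \<omega> / 2) / (1 - \<omega> / 2) + (1 + \<omega> / 2) * (2 * ?M u / r u v\<^sub>2))
          + \<omega> / 2 * (2 * ?M u / r u v\<^sub>2))"
      unfolding x_def \<eta>_def .
  qed (rule large)
  then have "r u\<^sub>s v\<^sub>2 < 2 * m u\<^sub>s v\<^sub>2 - 2 * m u\<^sub>s v\<^sub>1"
    using r2_pos[OF us_mem] by (simp add: field_simps)
  moreover have "0 \<le> m u\<^sub>s v\<^sub>1" using not_supercharged[of u\<^sub>s] coordinates by auto
  \<comment> \<open>Derived directly from the signs of the derivatives, because \<open>slice\<close>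
    does not cover \<open>u\<^sub>s = 0\<close>.\<close>
  moreover have "2 * m u\<^sub>s v\<^sub>2 \<le> r u\<^sub>s v\<^sub>2"
  proof -
    have "4 / (\<Omega> u\<^sub>s v\<^sub>2)\<^sup>2 * du r u\<^sub>s v\<^sub>2 * dv r u\<^sub>s v\<^sub>2 \<le> 0"
      using du_r_neg[OF us_mem v2] dv_r_nonneg[OF us_mem v2]
      by (intro mult_nonpos_nonneg mult_nonneg_nonpos) auto
    then have "r u\<^sub>s v\<^sub>2 * (1 + 4 / (\<Omega> u\<^sub>s v\<^sub>2)\<^sup>2 * du r u\<^sub>s v\<^sub>2 * dv r u\<^sub>s v\<^sub>2) \<le> r u\<^sub>s v\<^sub>2 * 1"
      using r2_pos[OF us_mem] by (intro mult_left_mono) auto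
    then show ?thesis by (simp add: hawking_mass_def)
  qed
  ultimately show False by simp
qed

end

theorem theorem1p3:
  fixes e :: real
    and r \<Omega> A :: "real \<Rightarrow> real \<Rightarrow> real"
    and \<phi> :: "real \<Rightarrow> real \<Rightarrow> complex"
    and \<gamma> :: "real \<Rightarrow> real"
    and u\<^sub>0 u\<^sub>s v\<^sub>1 v\<^sub>2 \<delta>\<^sub>0 \<eta>\<^sub>0 \<epsilon> L \<omega> :: real
  assumes sol: "EMCSF_solution e r \<Omega> A \<phi> \<gamma> u\<^sub>0 u\<^sub>s v\<^sub>1 v\<^sub>2"
    and \<delta>\<^sub>0_eq: "\<delta>\<^sub>0 = r u\<^sub>0 v\<^sub>2 / r u\<^sub>0 v\<^sub>1 - 1"
    and \<eta>\<^sub>0_eq: "\<eta>\<^sub>0 = 2 * (hawking_mass r \<Omega> u\<^sub>0 v\<^sub>2 - hawking_mass r \<Omega> u\<^sub>0 v\<^sub>1) / r u\<^sub>0 v\<^sub>2"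
    and u\<^sub>s_eq: "r u\<^sub>s v\<^sub>2 = 3 * \<delta>\<^sub>0 / (1 + \<delta>\<^sub>0) * r u\<^sub>0 v\<^sub>2"
    and \<epsilon>_bdd: "bdd_above {(charge r \<Omega> A u v)\<^sup>2 / (r u v)\<^sup>2 | u v.
           (u, v) \<in> outgoing_cone u\<^sub>0 \<union> incoming_cone u\<^sub>0 v\<^sub>1 \<and> r u v > 0}"
    and \<epsilon>_eq: "\<epsilon> = Sup {(charge r \<Omega> A u v)\<^sup>2 / (r u v)\<^sup>2 | u v.
           (u, v) \<in> outgoing_cone u\<^sub>0 \<union> incoming_cone u\<^sub>0 v\<^sub>1 \<and> r u v > 0}"
    and \<epsilon>_less: "\<epsilon> < 1"
    and L_eq: "L = (SUP (u, v) \<in> incoming_cone u\<^sub>0 v\<^sub>1. r u v * (cmod (\<phi> u v))\<^sup>2)"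
    and \<omega>_range: "\<omega> \<in> {0<..<2/3}"
    and small1: "9 * e\<^sup>2 / (4 * (1 - \<epsilon>)\<^sup>2) * (v\<^sub>2 - v\<^sub>1)\<^sup>2
           + 12 * pi * L * e\<^sup>2 / (1 - \<epsilon>) * (v\<^sub>2 - v\<^sub>1) \<le> \<omega> / 4"
    and small2: "\<forall>u\<in>{u\<^sub>0..0}. 45 * pi * e\<^sup>2 * (v\<^sub>2 - v\<^sub>1)\<^sup>2 / (pi * (1 - \<epsilon>)\<^sup>2)
           + 160 * pi * e\<^sup>2 * r u\<^sub>0 v\<^sub>2 * ((v\<^sub>2 - v\<^sub>1) / (1 - \<epsilon>)) * (cmod (\<phi> u v\<^sub>1))\<^sup>2 \<le> 4 * \<omega>"
    and not_supercharged: "\<forall>u\<in>{u\<^sub>0..0}. hawking_mass r \<Omega> u v\<^sub>1 \<ge> \<bar>charge r \<Omega> A u v\<^sub>1\<bar>"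
    and \<eta>\<^sub>0_large: "\<eta>\<^sub>0 > max (13 * \<epsilon> / \<omega> + g \<omega> \<delta>\<^sub>0)
           (9 / (2 powr (1 + \<omega> / 2) * (1 + \<delta>\<^sub>0)\<^sup>2) * \<delta>\<^sub>0 powr (1 - \<omega> / 2) + g \<omega> \<delta>\<^sub>0)"
  shows "\<exists>(u, v) \<in> {u\<^sub>0..u\<^sub>s} \<times> {v\<^sub>1..v\<^sub>2}. trapped_surface r u v"
proof (rule ccontr)
  assume untrapped: "\<not> ?thesis"
  interpret EMCSF_solution e r \<Omega> A \<phi> \<gamma> u\<^sub>0 u\<^sub>s v\<^sub>1 v\<^sub>2
    "initial_region u\<^sub>0 v\<^sub>1 \<gamma> \<union> {u\<^sub>0..u\<^sub>s} \<times> {v\<^sub>1..v\<^sub>2}"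
    by (rule sol)
  interpret untrapped_solution e r \<Omega> A \<phi> \<gamma> u\<^sub>0 u\<^sub>s v\<^sub>1 v\<^sub>2
    "initial_region u\<^sub>0 v\<^sub>1 \<gamma> \<union> {u\<^sub>0..u\<^sub>s} \<times> {v\<^sub>1..v\<^sub>2}" \<epsilon> L \<omega>
  proof
    show "(charge r \<Omega> A u v)\<^sup>2 / (r u v)\<^sup>2 \<le> \<epsilon>"
      if "(u, v) \<in> outgoing_cone u\<^sub>0 \<union> incoming_cone u\<^sub>0 v\<^sub>1" "0 < r u v" for u v
      unfolding \<epsilon>_eq using that by (intro cSup_upper[OF _ \<epsilon>_bdd]) blast
    show "r u v\<^sub>1 * (cmod (\<phi> u v\<^sub>1))\<^sup>2 \<le> L" if u: "u \<in> {u\<^sub>0..0}" for u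
    proof -
      \<comment> \<open>A real \<open>SUP\<close> bounds its members only if the set is bounded
        above; here compactness of the incoming cone supplies this.\<close>
      let ?f = "\<lambda>(u, v). r u v * (cmod (\<phi> u v))\<^sup>2"
      have "continuous_on (incoming_cone u\<^sub>0 v\<^sub>1) ?f"
      proof (intro continuous_at_imp_continuous_on ballI)
        fix p assume "p \<in> incoming_cone u\<^sub>0 v\<^sub>1"
        then have "(fst p, snd p) \<in> initial_region u\<^sub>0 v\<^sub>1 \<gamma> \<union> {u\<^sub>0..u\<^sub>s} \<times> {v\<^sub>1..v\<^sub>2} \<union> outgoing_cone u\<^sub>0"
          using incoming_mem by (auto simp: incoming_cone_def)
        from smooth_near_isCont[OF smooth_r this] smooth_near_isCont[OF smooth_\<phi> this]
        show "isCont ?f p"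
          unfolding case_prod_beta' by (intro continuous_intros) auto
      qed
      moreover have "compact (incoming_cone u\<^sub>0 v\<^sub>1)"
        unfolding incoming_cone_def by (intro compact_Times) auto
      ultimately have "bdd_above (?f ` incoming_cone u\<^sub>0 v\<^sub>1)"
        by (intro bounded_imp_bdd_above compact_imp_bounded compact_continuous_image)
      moreover have "(u, v\<^sub>1) \<in> incoming_cone u\<^sub>0 v\<^sub>1" using u by (simp add: incoming_cone_def)
      ultimately have "?f (u, v\<^sub>1) \<le> L"
        unfolding L_eq by (rule cSUP_upper[rotated])
      then show ?thesis by simp
    qed
  qed (use \<epsilon>_less \<omega>_range small1 small2 not_supercharged untrapped in auto)
  show False
    using mass_ratio_not_large[OF \<delta>\<^sub>0_eq u\<^sub>s_eq] \<eta>\<^sub>0_large unfolding \<eta>\<^sub>0_eq by blast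
qed

end
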